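(* Let $\Gamma\subset\mathbb{N}$ satisfy $$\sum_{\gamma\in\Gamma}\frac{1}{\sqrt{\gamma}}<\infty .$$ Then for every weight $w$ on $\mathbb{T}$ satisfying condition (A), the system $E(\mathbb{N}\setminus\Gamma)$ spans $L^2(\mathbb{T},w)$.
   Context: $\mathbb{N}=\{1,2,3,\dots\}$ and $\mathbb{T}=[0,1]$ is the circle. A weight $w$ on $\mathbb{T}$ is a nonnegative function with finite integral. For a discrete set $\Lambda\subset\mathbb{R}$, $E(\Lambda):=\{e^{2\pi i\lambda t}:\lambda\in\Lambda\}$. $L^2(\mathbb{T},w)$ is the space of functions $f$ on $\mathbb{T}$ with $\int_0^1|f(t)|^2w(t)\,dt<\infty$; a system spans this space if its finite linear combinations are dense in it (i.e. the system is complete). Condition (A) on a weight $w$: $w$ is positive, increasing and bounded on $(0,1)$ and satisfies $\int_0^1\log w(t)\,dt=-\infty$. *)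

theory Defs
  imports "HOL-Analysis.Analysis"
begin

abbreviation circle :: "real measure" where
  "circle \<equiv> lebesgue_on {0..1}"

text \<open>
  The integral over \<open>[0,1]\<close> with values in the extended reals. In \<^typ>\<open>ereal\<close>,
  \<open>\<infinity> - \<infinity> = \<infinity>\<close>; hence, for measurable \<open>g\<close>, the value \<open>-\<infinity>\<close> means exactly that
  the positive part of \<open>g\<close> has a finite integral and the negative part an infinite one.
\<close>

definition ext_integral :: "(real \<Rightarrow> real) \<Rightarrow> ereal" where
  "ext_integral g =
     enn2ereal (\<integral>\<^sup>+ t. ennreal (g t) \<partial>circle) - enn2ereal (\<integral>\<^sup>+ t. ennreal (- g t) \<partial>circle)"

definition weight :: "(real \<Rightarrow> real) \<Rightarrow> bool" where
  "weight w \<longleftrightarrow> (\<forall>t\<in>{0..1}. 0 \<le> w t) \<and> integrable circle w"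

text \<open>
  ``Increasing'' is taken in the weak sense. The strict sense would give the same class of
  spaces: \<open>w(t)\<close> and the strictly increasing \<open>(1 + t) w(t)\<close> define equivalent norms.
\<close>

definition condition_A :: "(real \<Rightarrow> real) \<Rightarrow> bool" where
  "condition_A w \<longleftrightarrow>
     (\<forall>t\<in>{0<..<1}. 0 < w t) \<and> mono_on {0<..<1} w \<and> bounded (w ` {0<..<1}) \<and>
     ext_integral (\<lambda>t. ln (w t)) = -\<infinity>"

text \<open>
  The elements of \<open>L\<^sup>2(w)\<close> are represented by functions rather than by classes of functions
  modulo equality almost everywhere; the norm below is accordingly a seminorm.
\<close>

definition L2 :: "(real \<Rightarrow> real) \<Rightarrow> (real \<Rightarrow> complex) set" where
  "L2 w = {f \<in> borel_measurable circle. integrable circle (\<lambda>t. (cmod (f t))\<^sup>2 * w t)}"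

definition L2_norm :: "(real \<Rightarrow> real) \<Rightarrow> (real \<Rightarrow> complex) \<Rightarrow> real" where
  "L2_norm w f = sqrt (LINT t|circle. (cmod (f t))\<^sup>2 * w t)"

definition exponentials :: "real set \<Rightarrow> (real \<Rightarrow> complex) set" where
  "exponentials \<Lambda> = (\<lambda>l t. exp (2 * of_real pi * \<i> * of_real l * of_real t)) ` \<Lambda>"

definition linear_combinations :: "(real \<Rightarrow> complex) set \<Rightarrow> (real \<Rightarrow> complex) set" where
  "linear_combinations S = {(\<lambda>t. \<Sum>g\<in>F. c g * g t) | F c. finite F \<and> F \<subseteq> S}"

definition spans_L2 :: "(real \<Rightarrow> complex) set \<Rightarrow> (real \<Rightarrow> real) \<Rightarrow> bool" where
  "spans_L2 S w \<longleftrightarrow> S \<subseteq> L2 w \<and>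
     (\<forall>f\<in>L2 w. \<forall>\<epsilon>>0. \<exists>p\<in>linear_combinations S. L2_norm w (\<lambda>t. f t - p t) < \<epsilon>)"

end

theory Submission
  imports Defs "HOL-Complex_Analysis.Complex_Analysis" "HOL-Real_Asymp.Real_Asymp"
begin

text \<open>
  Write \<open>z = e\<^bsup>2\<pi>it\<^esup>\<close>. The weight may be tiny only at \<open>t = 0+\<close>, but there it is so small that
  \<open>\<integral> log w = -\<infinity>\<close>. This is the situation of the Szego--Kolmogorov theorem: a function \<open>V\<close> analytic near the closed
  disc can have \<open>V(0) = 1\<close> and still be small in \<open>L\<^sup>2(w)\<close>, since \<open>log |V|\<close> may be about \<open>-M\<close> on most of
  the circle if it is allowed to be as large as \<open>\<onehalf> log (1/w)\<close> to the right of \<open>0\<close>. Such a \<open>V\<close> shows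
  that the constant \<open>1\<close> is a limit of linear combinations of \<open>z, z\<^sup>2, \<dots>\<close>.

  To get rid of the frequencies in \<open>\<Gamma>\<close>, apply to \<open>V\<close> the operator \<open>\<phi>(D)\<close> with \<open>D = (1/2\<pi>i) d/dt\<close> and
  \<open>\<phi>(x) = \<Prod>(1 - x/\<gamma>)\<close>. It multiplies the \<open>n\<close>-th Fourier coefficient by \<open>\<phi>(n)\<close>, so it annihilates
  every \<open>\<gamma> \<in> \<Gamma>\<close> and keeps the constant term. What does it cost? Let \<open>\<tau>\<close> be the distance from
  \<open>z\<close> to \<open>1\<close>, and let \<open>log V\<close> have derivative at most \<open>L/\<tau>\<^sup>2\<close> in a disc of radius comparable to \<open>\<tau>\<close>.
  Cauchy's inequalities on discs whose radius depends on the order of the derivative give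
  \<open>|\<phi>(D)V| \<le> 3 |V| \<Phi>(eL/\<tau>\<^sup>2)\<close> with \<open>\<Phi>(y) = \<Prod>(1 + y/\<gamma>)\<close> (\<open>norm_gap_op_le\<close>). Now the integral of
  \<open>log (1 + c\<^sup>2/t\<^sup>2)\<close> is a multiple of \<open>c\<close>, so \<open>log \<Phi>(eL/\<tau>\<^sup>2)\<close> has integral of order
  \<open>\<surd>L \<Sum> 1/\<surd>\<gamma>\<close>; here the hypothesis on \<open>\<Gamma>\<close> enters. The total mass \<open>M\<close> that creates the smallness
  of \<open>V\<close> is proportional to \<open>L\<close>, hence for large \<open>L\<close> the cost \<open>O(\<surd>L)\<close> is negligible against the gain
  \<open>M\<close>, and it can be paid by an explicit factor of \<open>V\<close> (the product of the factors \<open>damping\<close>), which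
  cancels \<open>\<Phi>(eL/\<tau>\<^sup>2)\<close> pointwise.

  The main factor of \<open>V\<close> is the exponential of a finite sum of Herglotz kernels. At every scale
  \<open>s = (1/4)\<^sup>k\<close> there is a kernel of positive mass with pole near \<open>e\<^bsup>is\<^esup>\<close>, paired with half of a kernel of
  negative mass with pole at \<open>1 + s\<close>. The first pole is so much closer to the circle than the second
  that the pair is negative except for \<open>t\<close> comparable to \<open>s\<close> (\<open>Re_herglotz_pole_dominated\<close>). There it
  may be as large as \<open>\<onehalf> log (1/w)\<close>. Monotonicity of \<open>w\<close> turns the divergence of the integral into
  the divergence of a sum over these scales (\<open>depth_sum_unbounded\<close>), which supplies the mass.

  To stay with finite objects, \<open>\<Gamma>\<close> is replaced by its part up to \<open>N\<close> and \<open>V\<close> by its Taylor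
  polynomial of degree \<open>N\<close>; all bounds are uniform in \<open>N\<close>. The result is \<open>small_polynomial_avoiding\<close>. Since the
  hypothesis on \<open>\<Gamma>\<close> survives translations, every \<open>e\<^bsup>2\<pi>imt\<^esup>\<close> with \<open>m \<in> \<int>\<close> is a limit of
  linear combinations of the given exponentials, and trigonometric polynomials are dense in \<open>L\<^sup>2(w)\<close>.
\<close>

section \<open>Polynomials with prescribed sparse roots\<close>

definition gap_poly :: "nat set \<Rightarrow> real poly" where
  "gap_poly F = (\<Prod>\<gamma>\<in>F. [:1, - (1 / real \<gamma>):])"

definition gap_majorant :: "nat set \<Rightarrow> real \<Rightarrow> real" where
  "gap_majorant F y = (\<Prod>\<gamma>\<in>F. 1 + y / real \<gamma>)"

lemma poly_gap_poly_zero: "poly (gap_poly F) 0 = 1"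
  by (simp add: gap_poly_def poly_prod)

lemma poly_gap_poly_root:
  assumes "finite F" "\<gamma> \<in> F" "\<gamma> > 0"
  shows "poly (gap_poly F) (real \<gamma>) = 0"
  using assms by (auto simp: gap_poly_def poly_prod)

text \<open>
  Replacing every root \<open>\<gamma>\<close> by \<open>-\<gamma>\<close> makes all coefficients nonnegative without changing their absolute
  values, so they can be estimated by values of the majorant at positive points.
\<close>

lemma coeff_gap_poly_majorant_poly:
  assumes "finite F"
  shows "\<bar>coeff (gap_poly F) j\<bar> \<le> coeff (\<Prod>\<gamma>\<in>F. [:1, 1 / real \<gamma>:]) j"
  using assms
proof (induction F arbitrary: j)
  case empty
  then show ?case by (simp add: gap_poly_def one_pCons coeff_pCons split: nat.split)
next
  case (insert g F)
  let ?q = "\<Prod>\<gamma>\<in>F. [:1, 1 / real \<gamma>:] :: real poly"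
  have eq: "gap_poly (insert g F) = [:1, - (1 / real g):] * gap_poly F"
    using insert.hyps by (simp add: gap_poly_def)
  have "\<bar>coeff (gap_poly (insert g F)) j\<bar> \<le> coeff ([:1, 1 / real g:] * ?q) j"
  proof (cases j)
    case 0
    then show ?thesis using insert.IH[of 0] by (simp add: eq)
  next
    case (Suc i)
    have "\<bar>coeff (gap_poly F) i\<bar> / real g \<le> coeff ?q i / real g"
      using insert.IH[of i] by (intro divide_right_mono) auto
    moreover have "\<bar>coeff (gap_poly F) (Suc i) - coeff (gap_poly F) i / real g\<bar>
        \<le> \<bar>coeff (gap_poly F) (Suc i)\<bar> + \<bar>coeff (gap_poly F) i\<bar> / real g"
      using abs_triangle_ineq4[of "coeff (gap_poly F) (Suc i)" "coeff (gap_poly F) i / real g"]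
      by simp
    ultimately show ?thesis using insert.IH[of "Suc i"] by (simp add: eq Suc)
  qed
  then show ?case using insert.hyps by simp
qed

lemma sum_coeff_gap_poly_le:
  assumes "finite F" "y \<ge> 0" "finite J"
  shows "(\<Sum>j\<in>J. \<bar>coeff (gap_poly F) j\<bar> * y ^ j) \<le> gap_majorant F y"
proof -
  let ?q = "\<Prod>\<gamma>\<in>F. [:1, 1 / real \<gamma>:] :: real poly"
  have nonneg: "coeff ?q j \<ge> 0" for j
    using coeff_gap_poly_majorant_poly[OF assms(1), of j] by linarith
  have "(\<Sum>j\<in>J. \<bar>coeff (gap_poly F) j\<bar> * y ^ j) \<le> (\<Sum>j\<in>J. coeff ?q j * y ^ j)"
    using assms coeff_gap_poly_majorant_poly by (intro sum_mono mult_right_mono) auto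
  also have "\<dots> \<le> (\<Sum>j\<in>J \<union> {..degree ?q}. coeff ?q j * y ^ j)"
    using assms nonneg by (intro sum_mono2) auto
  also have "\<dots> = (\<Sum>j\<le>degree ?q. coeff ?q j * y ^ j)"
    using assms by (intro sum.mono_neutral_right) (auto simp: coeff_eq_0)
  also have "\<dots> = gap_majorant F y"
    unfolding poly_altdef[symmetric] by (simp add: poly_prod gap_majorant_def mult.commute)
  finally show ?thesis .
qed

lemma one_plus_square_le_exp:
  fixes s :: real
  assumes "s \<ge> 0"
  shows "1 + s\<^sup>2 \<le> exp s"
proof -
  have "(1 + s / 2 + (s / 2)\<^sup>2 / 2)\<^sup>2 - (1 + s\<^sup>2) = (s - 2)\<^sup>2 * s / 8 + s / 2 + s ^ 4 / 64"
    by (simp add: power2_eq_square power4_eq_xxxx field_simps)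
  also have "\<dots> \<ge> 0" using assms by simp
  finally have "1 + s\<^sup>2 \<le> (1 + s / 2 + (s / 2)\<^sup>2 / 2)\<^sup>2" by simp
  also have "\<dots> \<le> (exp (s / 2))\<^sup>2"
    using assms exp_lower_Taylor_quadratic[of "s / 2"] by (intro power_mono) auto
  also have "\<dots> = exp s"
    by (simp add: exp_double[symmetric])
  finally show ?thesis .
qed

text \<open>
  Growth of order \<open>1/2\<close>, controlled by the sum in the hypothesis on the frequencies.
\<close>

lemma gap_majorant_le_exp:
  assumes "finite F" "y \<ge> 0" and \<beta>: "(\<Sum>\<gamma>\<in>F. 1 / sqrt (real \<gamma>)) \<le> \<beta>"
  shows "gap_majorant F y \<le> exp (\<beta> * sqrt y)"
proof -
  have "gap_majorant F y \<le> (\<Prod>\<gamma>\<in>F. exp (sqrt (y / real \<gamma>)))"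
    unfolding gap_majorant_def
  proof (intro prod_mono conjI)
    fix g
    show "1 + y / real g \<le> exp (sqrt (y / real g))"
      using one_plus_square_le_exp[of "sqrt (y / real g)"] \<open>y \<ge> 0\<close> by simp
  qed (use \<open>y \<ge> 0\<close> in auto)
  also have "\<dots> = exp ((\<Sum>\<gamma>\<in>F. 1 / sqrt (real \<gamma>)) * sqrt y)"
    using assms(1) by (simp add: exp_sum sum_distrib_right real_sqrt_divide)
  also have "\<dots> \<le> exp (\<beta> * sqrt y)"
    using \<beta> \<open>y \<ge> 0\<close> by (simp add: mult_right_mono)
  finally show ?thesis .
qed

lemma gap_majorant_ge_1: "y \<ge> 0 \<Longrightarrow> 1 \<le> gap_majorant F y"
  unfolding gap_majorant_def by (intro prod_ge_1) auto

text \<open>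
  Growth of order \<open>1/2\<close> is a decay of the coefficients like \<open>j\<^bsup>-2j\<^esup>\<close>; it beats the factor \<open>j!\<close> that
  Cauchy's inequality produces.
\<close>

lemma coeff_gap_poly_decay:
  assumes "finite F" and "(\<Sum>\<gamma>\<in>F. 1 / sqrt (real \<gamma>)) \<le> \<beta>" and "\<beta> > 0" "j > 0"
  shows "\<bar>coeff (gap_poly F) j\<bar> \<le> (exp 1 * \<beta>\<^sup>2 / real j ^ 2) ^ j"
proof -
  \<comment> \<open>this point makes \<open>exp (\<beta> \<surd>y)\<close> equal to \<open>e\<^sup>j\<close>\<close>
  define y where "y = (real j / \<beta>)\<^sup>2"
  have y: "y > 0" using assms by (simp add: y_def)
  have "\<bar>coeff (gap_poly F) j\<bar> * y ^ j \<le> gap_majorant F y"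
    using sum_coeff_gap_poly_le[of F y "{j}"] assms y by simp
  also have "\<dots> \<le> exp (\<beta> * sqrt y)"
    using gap_majorant_le_exp assms y by simp
  also have "\<dots> = exp 1 ^ j"
    using assms by (simp add: y_def exp_of_nat_mult[symmetric])
  finally have "\<bar>coeff (gap_poly F) j\<bar> \<le> exp 1 ^ j / y ^ j"
    using y by (simp add: field_simps)
  also have "\<dots> = (exp 1 * \<beta>\<^sup>2 / real j ^ 2) ^ j"
    by (simp add: y_def power_divide power_mult_distrib)
  finally show ?thesis .
qed


section \<open>The differential operator with a sparse symbol\<close>

text \<open>
  The operator \<open>\<phi>(D)\<close> with \<open>\<phi>\<close> the polynomial above and \<open>D = (1/2\<pi>i) d/dt\<close>, normalised so that
  \<open>e\<^bsup>2\<pi>int\<^esup>\<close> is an eigenfunction with eigenvalue \<open>\<phi>(n)\<close>.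
\<close>

definition gap_op :: "nat set \<Rightarrow> (complex \<Rightarrow> complex) \<Rightarrow> complex \<Rightarrow> complex" where
  "gap_op F f t = (\<Sum>j\<le>degree (gap_poly F).
     of_real (coeff (gap_poly F) j) * ((deriv ^^ j) f t / (2 * of_real pi * \<i>) ^ j))"

lemma gap_op_diff:
  assumes "f holomorphic_on S" "g holomorphic_on S" "open S" "t \<in> S"
  shows "gap_op F (\<lambda>z. f z - g z) t = gap_op F f t - gap_op F g t"
  unfolding gap_op_def using assms
  by (simp add: higher_deriv_diff[of f S g] diff_divide_distrib right_diff_distrib sum_subtractf)

lemma higher_deriv_exponential_sum:
  fixes a \<mu> :: "nat \<Rightarrow> complex"
  shows "(deriv ^^ j) (\<lambda>\<zeta>. \<Sum>n\<in>A. a n * exp (\<mu> n * \<zeta>)) = (\<lambda>\<zeta>. \<Sum>n\<in>A. a n * \<mu> n ^ j * exp (\<mu> n * \<zeta>))"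
proof (induction j)
  case 0
  then show ?case by simp
next
  case (Suc j)
  have "deriv (\<lambda>\<zeta>. \<Sum>n\<in>A. a n * \<mu> n ^ j * exp (\<mu> n * \<zeta>)) \<zeta> =
        (\<Sum>n\<in>A. a n * \<mu> n ^ Suc j * exp (\<mu> n * \<zeta>))" for \<zeta>
    by (rule DERIV_imp_deriv) (auto intro!: derivative_eq_intros sum.cong simp: mult_ac)
  then show ?case using Suc by auto
qed

lemma gap_op_exponential_sum:
  "gap_op F (\<lambda>\<zeta>. \<Sum>n\<in>A. a n * exp (2 * of_real pi * \<i> * of_nat n * \<zeta>)) t =
   (\<Sum>n\<in>A. of_real (poly (gap_poly F) (real n)) * a n * exp (2 * of_real pi * \<i> * of_nat n * t))"
proof -
  have "gap_op F (\<lambda>\<zeta>. \<Sum>n\<in>A. a n * exp (2 * of_real pi * \<i> * of_nat n * \<zeta>)) t =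
    (\<Sum>j\<le>degree (gap_poly F). \<Sum>n\<in>A. of_real (coeff (gap_poly F) j * real n ^ j) * (a n * exp (2 * of_real pi * \<i> * of_nat n * t)))"
    unfolding gap_op_def higher_deriv_exponential_sum
    by (intro sum.cong refl) (simp add: sum_distrib_left sum_divide_distrib power_mult_distrib field_simps)
  also have "\<dots> = (\<Sum>n\<in>A. of_real (poly (gap_poly F) (real n)) * a n * exp (2 * of_real pi * \<i> * of_nat n * t))"
    by (subst sum.swap) (simp add: poly_altdef sum_distrib_right sum_distrib_left mult_ac)
  finally show ?thesis .
qed


text \<open>
  If \<open>f\<close> varies at the exponential rate \<open>D\<close>, then its \<open>j\<close>-th derivative has size about \<open>(eD)\<^sup>j\<close>: this is
  Cauchy's inequality on the disc of radius \<open>j/D\<close>, where \<open>j\<^sup>j r\<^bsup>-j\<^esup> e\<^bsup>Dr\<^esup>\<close> is smallest. Such discs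
  are available for \<open>j \<le> D r\<^sub>0\<close> only. For larger \<open>j\<close> the largest disc is used, and the decay of
  the coefficients turns these terms into a geometric series as soon as \<open>D r\<^sub>0\<^sup>2\<close> is large.
\<close>

lemma norm_gap_op_le:
  fixes t :: complex and \<beta> D A r\<^sub>0 :: real
  assumes "finite F" "(\<Sum>\<gamma>\<in>F. 1 / sqrt (real \<gamma>)) \<le> \<beta>" "\<beta> > 0"
    and holo: "f holomorphic_on S" "cball t r\<^sub>0 \<subseteq> S" and "r\<^sub>0 > 0" "D > 0" "A \<ge> 0"
    and growth: "\<And>\<zeta>. \<zeta> \<in> cball t r\<^sub>0 \<Longrightarrow> norm (f \<zeta>) \<le> A * exp (D * dist t \<zeta>)"
    and large: "2 * (exp 1)\<^sup>2 * \<beta>\<^sup>2 \<le> D * r\<^sub>0\<^sup>2"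
  shows "norm (gap_op F f t) \<le> A * (gap_majorant F (exp 1 * D) + 2)"
proof -
  let ?c = "\<lambda>j. \<bar>coeff (gap_poly F) j\<bar>"
  have cauchy: "norm ((deriv ^^ j) f t) \<le> fact j * (A * exp (D * r)) / r ^ j"
    if "0 < r" "r \<le> r\<^sub>0" for r j
  proof (rule Cauchy_inequality)
    have sub: "cball t r \<subseteq> S" using that holo(2) by (force simp: subset_iff)
    then show "f holomorphic_on ball t r"
      using holo(1) ball_subset_cball by (blast intro: holomorphic_on_subset)
    show "continuous_on (cball t r) f"
      using holo(1) sub holomorphic_on_imp_continuous_on holomorphic_on_subset by blast
    show "norm (f x) \<le> A * exp (D * r)" if "norm (t - x) = r" for x
      using growth[of x] that \<open>r \<le> r\<^sub>0\<close> by (simp add: dist_norm)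
  qed (use that in auto)
  have term_le: "?c j * norm ((deriv ^^ j) f t) \<le> A * (?c j * (exp 1 * D) ^ j + (1/2) ^ j)" for j
  proof -
    consider "j = 0" | "j > 0" "real j \<le> D * r\<^sub>0" | "j > 0" "real j > D * r\<^sub>0" by linarith
    then show ?thesis
    proof cases
      case 1
      have "norm (f t) \<le> A" using growth[of t] \<open>r\<^sub>0 > 0\<close> by simp
      then have "?c 0 * norm (f t) \<le> ?c 0 * A" by (intro mult_left_mono) auto
      then show ?thesis using 1 \<open>A \<ge> 0\<close> by (simp add: algebra_simps)
    next
      case 2
      \<comment> \<open>the radius that minimises \<open>exp (D r) / r ^ j\<close>\<close>
      define r where "r = real j / D"
      have r: "0 < r" "r \<le> r\<^sub>0" using 2 \<open>D > 0\<close> by (auto simp: r_def field_simps)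
      have "norm ((deriv ^^ j) f t) \<le> fact j * (A * exp (D * r)) / r ^ j" by (rule cauchy[OF r])
      also have "\<dots> \<le> real j ^ j * (A * exp (D * r)) / r ^ j"
        using r \<open>A \<ge> 0\<close> fact_le_power[of j, where 'a = real]
        by (intro divide_right_mono mult_right_mono) auto
      also have "exp (D * r) = exp 1 ^ j"
        using \<open>D > 0\<close> by (simp add: r_def exp_of_nat_mult[symmetric])
      also have "real j ^ j * (A * exp 1 ^ j) / r ^ j = A * (exp 1 * D) ^ j"
        using 2 \<open>D > 0\<close> by (simp add: r_def power_divide power_mult_distrib)
      finally have "?c j * norm ((deriv ^^ j) f t) \<le> ?c j * (A * (exp 1 * D) ^ j)"
        by (intro mult_left_mono) auto
      also have "\<dots> \<le> A * (?c j * (exp 1 * D) ^ j + (1/2) ^ j)"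
        using \<open>A \<ge> 0\<close> by (simp add: algebra_simps)
      finally show ?thesis .
    next
      case 3
      have "norm ((deriv ^^ j) f t) \<le> fact j * (A * exp (D * r\<^sub>0)) / r\<^sub>0 ^ j"
        using \<open>r\<^sub>0 > 0\<close> by (intro cauchy) auto
      also have "\<dots> \<le> real j ^ j * (A * exp 1 ^ j) / r\<^sub>0 ^ j"
      proof -
        have "exp (D * r\<^sub>0) \<le> exp 1 ^ j" using 3 by (simp add: exp_of_nat_mult[symmetric])
        then show ?thesis using \<open>r\<^sub>0 > 0\<close> \<open>A \<ge> 0\<close> fact_le_power[of j, where 'a = real]
          by (intro divide_right_mono mult_mono mult_left_mono) auto
      qed
      finally have "?c j * norm ((deriv ^^ j) f t) \<le>
          (exp 1 * \<beta>\<^sup>2 / real j ^ 2) ^ j * (real j ^ j * (A * exp 1 ^ j) / r\<^sub>0 ^ j)"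
        using coeff_gap_poly_decay[OF assms(1,2,3) \<open>j > 0\<close>] by (intro mult_mono) auto
      also have "\<dots> = A * ((exp 1)\<^sup>2 * \<beta>\<^sup>2 / (real j * r\<^sub>0)) ^ j"
      proof -
        have "(exp 1)\<^sup>2 * \<beta>\<^sup>2 / (real j * r\<^sub>0) = (exp 1 * \<beta>\<^sup>2 / real j ^ 2) * (real j * exp 1 / r\<^sub>0)"
          using \<open>j > 0\<close> by (simp add: field_simps power2_eq_square)
        then show ?thesis by (simp add: power_mult_distrib power_divide mult_ac)
      qed
      also have "\<dots> \<le> A * (1/2) ^ j"
      proof (intro mult_left_mono power_mono)
        have "2 * (exp 1)\<^sup>2 * \<beta>\<^sup>2 \<le> (D * r\<^sub>0) * r\<^sub>0" using large by (simp add: power2_eq_square mult_ac)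
        also have "\<dots> \<le> real j * r\<^sub>0" using 3 \<open>r\<^sub>0 > 0\<close> by (intro mult_right_mono) auto
        finally show "(exp 1)\<^sup>2 * \<beta>\<^sup>2 / (real j * r\<^sub>0) \<le> 1 / 2"
          using \<open>j > 0\<close> \<open>r\<^sub>0 > 0\<close> by (simp add: field_simps)
      qed (use \<open>A \<ge> 0\<close> \<open>r\<^sub>0 > 0\<close> in auto)
      also have "\<dots> \<le> A * (?c j * (exp 1 * D) ^ j + (1/2) ^ j)"
        using \<open>A \<ge> 0\<close> \<open>D > 0\<close> by (intro mult_left_mono) auto
      finally show ?thesis .
    qed
  qed
  let ?d = "degree (gap_poly F)"
  have "norm (gap_op F f t) \<le> (\<Sum>j\<le>?d. ?c j * norm ((deriv ^^ j) f t))"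
    unfolding gap_op_def
  proof (rule sum_norm_le)
    fix j
    have "(1::real) \<le> (2 * pi) ^ j" using pi_gt3 by (intro one_le_power) auto
    then have "?c j * norm ((deriv ^^ j) f t) / (2 * pi) ^ j \<le> ?c j * norm ((deriv ^^ j) f t) / 1"
      by (intro divide_left_mono) auto
    then show "norm (of_real (coeff (gap_poly F) j) * ((deriv ^^ j) f t / (2 * of_real pi * \<i>) ^ j))
      \<le> ?c j * norm ((deriv ^^ j) f t)"
      by (simp add: norm_mult norm_divide norm_power)
  qed
  also have "\<dots> \<le> (\<Sum>j\<le>?d. A * (?c j * (exp 1 * D) ^ j + (1/2) ^ j))"
    by (intro sum_mono term_le)
  also have "\<dots> = A * ((\<Sum>j\<le>?d. ?c j * (exp 1 * D) ^ j) + (\<Sum>j\<le>?d. (1/2) ^ j))"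
    by (simp only: sum_distrib_left[symmetric] sum.distrib)
  also have "\<dots> \<le> A * (gap_majorant F (exp 1 * D) + 2)"
  proof (intro mult_left_mono add_mono)
    have "(\<Sum>j\<le>?d. (1/2::real) ^ j) \<le> (\<Sum>j. (1/2) ^ j)"
      by (intro sum_le_suminf summable_geometric) auto
    also have "\<dots> = 2" by (simp add: suminf_geometric)
    finally show "(\<Sum>j\<le>?d. (1/2::real) ^ j) \<le> 2" .
  qed (use assms sum_coeff_gap_poly_le in auto)
  finally show ?thesis .
qed

section \<open>Herglotz kernels and damping factors\<close>

text \<open>
  The kernel has value \<open>1\<close> at the origin and, for a pole outside the disc, its real part on the circle
  is a Poisson kernel. It is analytic across the circle, unlike the kernel with pole on the circle.
\<close>

definition herglotz :: "complex \<Rightarrow> complex \<Rightarrow> complex" where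
  "herglotz p z = (p + z) / (p - z)"

lemma herglotz_0: "p \<noteq> 0 \<Longrightarrow> herglotz p 0 = 1"
  by (simp add: herglotz_def)

lemma Re_herglotz_circle:
  assumes "norm z = 1"
  shows "Re (herglotz p z) = ((norm p)\<^sup>2 - 1) / (norm (p - z))\<^sup>2"
proof -
  have "1 = (Re z)\<^sup>2 + (Im z)\<^sup>2" using assms by (simp add: cmod_power2[symmetric])
  then show ?thesis
    unfolding herglotz_def Re_divide cmod_power2 by (simp add: power2_eq_square algebra_simps)
qed

lemma herglotz_diff:
  assumes "p \<noteq> z" "p \<noteq> z'"
  shows "herglotz p z' - herglotz p z = 2 * p * (z' - z) / ((p - z') * (p - z))"
  using assms by (simp add: herglotz_def divide_simps) (simp add: algebra_simps)

lemma norm_herglotz_diff_le: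
  assumes "norm p \<le> 2" "d > 0" "d \<le> norm (p - z)" "norm (z' - z) \<le> d / 2"
  shows "norm (herglotz p z' - herglotz p z) \<le> 8 * norm (z' - z) / d\<^sup>2"
proof -
  have far: "norm (p - z') \<ge> d / 2"
    using assms norm_triangle_ineq[of "p - z'" "z' - z"] by simp
  have "p \<noteq> z" "p \<noteq> z'" using assms far by auto
  then have "norm (herglotz p z' - herglotz p z) = 2 * norm p * norm (z' - z) / (norm (p - z') * norm (p - z))"
    by (simp add: herglotz_diff norm_mult norm_divide)
  also have "\<dots> \<le> 2 * 2 * norm (z' - z) / (d / 2 * d)"
    using assms far by (intro frac_le mult_mono) auto
  also have "\<dots> = 8 * norm (z' - z) / d\<^sup>2" by (simp add: power2_eq_square)
  finally show ?thesis .
qed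

text \<open>
  For \<open>R\<close> slightly above \<open>1\<close> this factor costs only \<open>log (1 + c)\<close> at the origin, but near the point
  \<open>z\<close> of the circle its square absorbs a factor \<open>1 + c\<^sup>2/|R - z|\<^sup>2\<close>.
\<close>

definition damping :: "real \<Rightarrow> real \<Rightarrow> complex \<Rightarrow> complex" where
  "damping R c z = (of_real R - z) / (of_real (R + c) - z)"

text \<open>
  The angle at \<open>R\<close> between the segments to \<open>z\<close> and to \<open>R + c\<close> is not acute.
\<close>

lemma norm_shift_ge:
  assumes "Re z \<le> R" "c \<ge> 0"
  shows "(norm (of_real R - z))\<^sup>2 + c\<^sup>2 \<le> (norm (of_real (R + c) - z))\<^sup>2"
proof -
  have "(norm (of_real (R + c) - z))\<^sup>2 = (norm (of_real R - z))\<^sup>2 + c\<^sup>2 + 2 * c * (R - Re z)"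
    unfolding cmod_power2 by (simp add: power2_eq_square algebra_simps)
  then show ?thesis using assms by simp
qed

lemma norm_shift_mono:
  assumes "Re z \<le> R" "c \<ge> 0"
  shows "norm (of_real R - z) \<le> norm (of_real (R + c) - z)"
proof (rule power2_le_imp_le)
  show "(norm (of_real R - z))\<^sup>2 \<le> (norm (of_real (R + c) - z))\<^sup>2"
    using norm_shift_ge[OF assms] zero_le_power2[of c] by linarith
qed auto

lemma norm_damping_square_le:
  assumes "Re z < R" "c \<ge> 0"
  shows "(norm (damping R c z))\<^sup>2 \<le> 1 / (1 + c\<^sup>2 / (norm (of_real R - z))\<^sup>2)"
proof -
  let ?d = "norm (of_real R - z)"
  have d: "?d > 0" using assms by auto
  have "(norm (damping R c z))\<^sup>2 = ?d\<^sup>2 / (norm (of_real (R + c) - z))\<^sup>2"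
    by (simp add: damping_def norm_divide power_divide)
  also have "\<dots> \<le> ?d\<^sup>2 / (?d\<^sup>2 + c\<^sup>2)"
  proof (rule divide_left_mono)
    have "0 < ?d\<^sup>2 + c\<^sup>2" using d by (simp add: add_pos_nonneg)
    moreover from this have "0 < (norm (of_real (R + c) - z))\<^sup>2"
      using norm_shift_ge[of z R c] assms by linarith
    ultimately show "0 < (norm (of_real (R + c) - z))\<^sup>2 * (?d\<^sup>2 + c\<^sup>2)" by (rule mult_pos_pos[rotated])
  qed (use norm_shift_ge[of z R c] assms in auto)
  also have "\<dots> = 1 / (1 + c\<^sup>2 / ?d\<^sup>2)" using d by (simp add: field_simps)
  finally show ?thesis .
qed

lemma norm_damping_0:
  assumes "R \<ge> 1" "c \<ge> 0"
  shows "1 / (1 + c) \<le> norm (damping R c 0)"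
proof -
  have "1 * c \<le> R * c" using assms by (intro mult_right_mono) auto
  then have "1 / (1 + c) \<le> R / (R + c)" using assms by (simp add: field_simps)
  also have "\<dots> = norm (damping R c 0)" using assms
    unfolding damping_def by (simp add: norm_divide del: of_real_add)
  finally show ?thesis .
qed

lemma norm_damping_ratio_le:
  assumes "Re z < R" "c \<ge> 0" and z': "norm (z' - z) \<le> norm (of_real R - z) / 2"
  shows "norm (damping R c z') \<le> norm (damping R c z) * exp (2 * c * norm (z' - z) / (norm (of_real R - z))\<^sup>2)"
proof -
  let ?d = "norm (of_real R - z)"
  have d: "?d > 0" using assms by auto
  have ge: "norm (of_real (R + c) - z) \<ge> ?d" using norm_shift_mono assms by auto
  have far: "norm (of_real (R + c) - z') \<ge> ?d / 2"
  proof -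
    have "norm (of_real (R + c) - z) \<le> norm (of_real (R + c) - z') + norm (z' - z)"
      using dist_triangle[of "of_real (R + c)" z z'] by (simp only: dist_norm)
    then show ?thesis using ge z' by linarith
  qed
  have nz: "of_real R \<noteq> z" "of_real (R + c) \<noteq> z" "of_real (R + c) \<noteq> z'"
    using d ge far by (auto simp del: of_real_add)
  have "damping R c z' = damping R c z * (1 + c * (z - z') / ((of_real R - z) * (of_real (R + c) - z')))"
    using nz unfolding damping_def by (simp add: divide_simps) (simp add: algebra_simps)
  also have "norm \<dots> \<le> norm (damping R c z) * (1 + 2 * c * norm (z' - z) / ?d\<^sup>2)"
    unfolding norm_mult
  proof (intro mult_left_mono)
    have "norm (1 + c * (z - z') / ((of_real R - z) * (of_real (R + c) - z')))
       \<le> norm (1::complex) + norm (c * (z - z') / ((of_real R - z) * (of_real (R + c) - z')))"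
      by (rule norm_triangle_ineq)
    also have "norm (c * (z - z') / ((of_real R - z) * (of_real (R + c) - z'))) =
        c * norm (z' - z) / (?d * norm (of_real (R + c) - z'))"
      using \<open>c \<ge> 0\<close> by (simp add: norm_mult norm_divide norm_minus_commute del: of_real_add)
    also have "\<dots> \<le> c * norm (z' - z) / (?d * (?d / 2))"
    proof (rule divide_left_mono)
      have "norm (of_real (R + c) - z') > 0" using d far by linarith
      then show "0 < (?d * norm (of_real (R + c) - z')) * (?d * (?d / 2))"
        using d by (simp del: of_real_add)
    qed (use d far \<open>c \<ge> 0\<close> in \<open>auto simp del: of_real_add intro!: mult_left_mono\<close>)
    also have "\<dots> = 2 * c * norm (z' - z) / ?d\<^sup>2" by (simp add: power2_eq_square)
    finally show "norm (1 + c * (z - z') / ((of_real R - z) * (of_real (R + c) - z'))) \<le> 1 + 2 * c * norm (z' - z) / ?d\<^sup>2"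
      by simp
  qed auto
  also have "\<dots> \<le> norm (damping R c z) * exp (2 * c * norm (z' - z) / ?d\<^sup>2)"
    by (intro mult_left_mono exp_ge_add_one_self) auto
  finally show ?thesis .
qed

section \<open>Poles on one side of the point 1\<close>

text \<open>
  A point at height \<open>s/200\<close> above the circle, at arc length \<open>s\<close> from \<open>1\<close>. The height is a small fraction
  of \<open>s\<close>, so that the Poisson kernel of this point is concentrated on arcs that are short compared with
  their distance to \<open>1\<close>.
\<close>

definition pole :: "real \<Rightarrow> complex" where
  "pole s = of_real (1 + s / 200) * cis s"

lemma norm_pole: "s \<ge> 0 \<Longrightarrow> norm (pole s) = 1 + s / 200"
  unfolding pole_def norm_mult norm_of_real by simp

lemma norm_pole_minus_1_le:
  assumes "s \<ge> 0"
  shows "norm (pole s - 1) \<le> s + s / 200"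
proof -
  have "norm (cis s - 1) = 2 * \<bar>sin (s / 2)\<bar>"
    using dist_exp_i_1[of s] by (simp add: cis_conv_exp)
  also have "\<dots> \<le> s" using abs_sin_x_le_abs_x[of "s / 2"] assms by simp
  finally have "norm (cis s - 1) \<le> s" .
  moreover have "norm (of_real (s / 200) * cis s) = s / 200"
    using assms unfolding norm_mult norm_of_real by simp
  ultimately have "norm ((cis s - 1) + of_real (s / 200) * cis s) \<le> s + s / 200"
    by (intro norm_triangle_mono) auto
  then show ?thesis by (simp add: pole_def algebra_simps)
qed

lemma sin_ge_linear:
  fixes x :: real
  assumes "0 \<le> x" "x \<le> 4 / 5"
  shows "17 / 20 * x \<le> sin x"
proof -
  have "\<bar>sin x - (\<Sum>m<3. sin_coeff m * x ^ m)\<bar> \<le> inverse (fact 3) * \<bar>x\<bar> ^ 3"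
    by (rule Maclaurin_sin_bound)
  then have "\<bar>sin x - x\<bar> \<le> x ^ 3 / 6"
    using assms by (simp add: eval_nat_numeral sin_coeff_def)
  then have "sin x \<ge> x - x ^ 3 / 6" by linarith
  moreover have "x ^ 3 \<le> (4 / 5)\<^sup>2 * x"
    using assms by (auto simp: power3_eq_cube power2_eq_square[symmetric] intro!: mult_right_mono power_mono)
  ultimately show ?thesis using assms by (simp add: power2_eq_square)
qed

lemma norm_pole_minus_circle_ge:
  assumes "s \<ge> 0" "norm z = 1"
  shows "s / 200 \<le> norm (pole s - z)"
  using norm_triangle_ineq2[of "pole s" z] norm_pole[of s] assms by simp

lemma Re_herglotz_pole_le:
  assumes "0 < s" "s \<le> 1 / 4" "norm z = 1"
  shows "Re (herglotz (pole s) z) \<le> 600 / s"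
proof -
  have X: "s / 200 \<le> norm (pole s - z)" using assms by (intro norm_pole_minus_circle_ge) auto
  have "Re (herglotz (pole s) z) = ((1 + s / 200)\<^sup>2 - 1) / (norm (pole s - z))\<^sup>2"
    using assms by (simp add: Re_herglotz_circle norm_pole)
  also have "\<dots> \<le> ((1 + s / 200)\<^sup>2 - 1) / (s / 200)\<^sup>2"
  proof (intro divide_left_mono power_mono mult_pos_pos)
    show "0 < (norm (pole s - z))\<^sup>2" using X assms by (intro zero_less_power) linarith
  qed (use X assms in \<open>auto simp: power2_eq_square algebra_simps\<close>)
  also have "\<dots> \<le> 600 / s" using assms by (simp add: field_simps power2_eq_square)
  finally show ?thesis .
qed

text \<open>
  At a distance of at least \<open>s/4\<close> from \<open>pole s\<close>, the distances of \<open>z\<close> to \<open>pole s\<close> and to \<open>1 + s\<close> are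
  comparable, with ratio at most \<open>10\<close>. The numerators of the two Poisson kernels are comparable to the heights of
  the poles, which differ by the factor \<open>200 = 2 \<cdot> 10\<^sup>2\<close>.
\<close>

lemma Re_herglotz_pole_dominated:
  assumes "0 < s" "s \<le> 1 / 4" "norm z = 1" and far: "s / 4 \<le> norm (pole s - z)"
  shows "Re (herglotz (pole s) z) \<le> Re (herglotz (of_real (1 + s)) z) / 2"
proof -
  let ?X = "norm (pole s - z)" and ?Y = "norm (of_real (1 + s) - z)"
  have "?Y \<le> ?X + norm (of_real (1 + s) - pole s)"
    using dist_triangle[of "of_real (1 + s)" z "pole s"] by (simp add: dist_norm)
  also have "norm (of_real (1 + s) - pole s) \<le> norm (of_real s :: complex) + norm (pole s - 1)"
    using norm_triangle_ineq4[of "of_real s" "pole s - 1"] by (simp add: algebra_simps)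
  also have "\<dots> \<le> s + (s + s / 200)" using assms norm_pole_minus_1_le[of s] by simp
  finally have "?Y \<le> ?X + (s + (s + s / 200))" by simp
  then have Y: "?Y \<le> 10 * ?X" using far assms(1) by linarith
  have "norm (of_real (1 + s) :: complex) = 1 + s" using assms by (simp del: of_real_add)
  then have Y0: "?Y > 0" using assms(1,3) by (metis zero_less_norm_iff eq_iff_diff_eq_0 add.commute less_add_same_cancel2 less_irrefl)
  have X0: "?X > 0" using far assms by linarith
  have Y2: "?Y\<^sup>2 \<le> 100 * ?X\<^sup>2" using power_mono[OF Y, of 2] by (simp add: power_mult_distrib)
  have "Re (herglotz (pole s) z) = ((1 + s / 200)\<^sup>2 - 1) / ?X\<^sup>2"
    using assms by (simp add: Re_herglotz_circle norm_pole)
  also have "\<dots> \<le> (((1 + s)\<^sup>2 - 1) / 200) / ?X\<^sup>2"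
    using assms by (intro divide_right_mono) (auto simp: power2_eq_square field_simps)
  also have "\<dots> = (((1 + s)\<^sup>2 - 1) / 2) / (100 * ?X\<^sup>2)" by simp
  also have "\<dots> \<le> (((1 + s)\<^sup>2 - 1) / 2) / ?Y\<^sup>2"
    using assms Y2 X0 Y0 by (intro divide_left_mono) (auto simp: power2_eq_square algebra_simps)
  also have "\<dots> = Re (herglotz (of_real (1 + s)) z) / 2"
    using assms \<open>norm (of_real (1 + s) :: complex) = 1 + s\<close> by (simp add: Re_herglotz_circle)
  finally show ?thesis .
qed

lemma Im_pole_ge:
  assumes "0 < s" "s \<le> 1 / 4"
  shows "17 / 20 * s \<le> Im (pole s)"
proof -
  have "17 / 20 * s \<le> sin s" using assms by (intro sin_ge_linear) auto
  also have "\<dots> \<le> (1 + s / 200) * sin s"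
    using assms \<open>17 / 20 * s \<le> sin s\<close> by (simp add: algebra_simps)
  finally show ?thesis by (simp add: pole_def)
qed

text \<open>
  For an increasing weight, the pair of kernels at scale \<open>s\<close> is thus positive only where \<open>w(t) \<le> w(s/2)\<close>.
\<close>

lemma near_pole_position:
  assumes "0 < s" "s \<le> 1 / 4" "0 < t" "t < 1" and near: "norm (pole s - cis (2 * pi * t)) < s / 4"
  shows "t \<le> s / 2"
proof (rule ccontr)
  assume "\<not> t \<le> s / 2"
  let ?\<theta> = "2 * pi * t"
  have gt: "pi * s < ?\<theta>" using \<open>\<not> t \<le> s / 2\<close> pi_gt_zero by simp
  have im: "\<bar>Im (pole s) - sin ?\<theta>\<bar> < s / 4" and re: "\<bar>Re (pole s) - cos ?\<theta>\<bar> < s / 4"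
    using near abs_Im_le_cmod[of "pole s - cis ?\<theta>"] abs_Re_le_cmod[of "pole s - cis ?\<theta>"] by auto
  have "sin ?\<theta> > 0" using im Im_pole_ge[OF assms(1,2)] assms(1) by linarith
  then have "?\<theta> < pi"
    using sin_le_zero[of ?\<theta>] assms by (meson le_less_trans linorder_not_le mult_less_cancel_left2 not_less pi_gt_zero zero_less_mult_iff zero_less_numeral)
  have "cos s \<ge> cos (pi / 3)" using assms pi_gt3 by (intro cos_monotone_0_pi_le) auto
  then have "cos s \<ge> 1 / 2" by (simp add: cos_60)
  have "?\<theta> < pi / 2"
  proof (rule ccontr)
    assume "\<not> ?\<theta> < pi / 2"
    then have "cos ?\<theta> \<le> cos (pi / 2)"
      using \<open>?\<theta> < pi\<close> by (intro cos_monotone_0_pi_le) auto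
    then have "cos ?\<theta> \<le> 0" by simp
    moreover have "Re (pole s) \<ge> 1 / 2"
    proof -
      have "1 * cos s \<le> (1 + s / 200) * cos s"
        using \<open>cos s \<ge> 1 / 2\<close> assms(1) by (intro mult_right_mono) auto
      also have "\<dots> = Re (pole s)" by (simp add: pole_def)
      finally show ?thesis using \<open>cos s \<ge> 1 / 2\<close> by linarith
    qed
    ultimately show False using re assms by linarith
  qed
  moreover have "0 \<le> pi * s" using assms(1) by simp
  ultimately have "sin (pi * s) \<le> sin ?\<theta>" using gt pi_gt_zero by (intro sin_monotone_2pi_le) linarith+
  moreover have "17 / 20 * (pi * s) \<le> sin (pi * s)"
    using assms pi_less_4 mult_mono[of pi "16 / 5" s "1 / 4"] pi_approx by (intro sin_ge_linear) auto
  moreover have "3 * s \<le> pi * s" using assms pi_gt3 by (intro mult_right_mono) auto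
  moreover have "Im (pole s) \<le> (1 + s / 200) * s"
    using assms sin_x_le_x[of s] by (simp add: pole_def)
  moreover have "(1 + s / 200) * s \<le> (1 + 1 / 800) * s" using assms by (intro mult_right_mono) auto
  moreover have "sin ?\<theta> < Im (pole s) + s / 4" using im by linarith
  ultimately have "17 / 20 * (3 * s) < (1 + 1 / 800) * s + s / 4" by linarith
  then show False using assms(1) by simp
qed

text \<open>
  If consecutive scales differ by a factor of at least \<open>4\<close>, every point of the circle is close to at most one pole.
\<close>

lemma near_pole_unique:
  assumes "0 < s" "s \<le> 1 / 4" "0 < s'" "s' \<le> s / 4"
    and near: "norm (pole s - z) < s / 4" and near': "norm (pole s' - z) < s' / 4"
  shows False
proof -
  have "17 / 20 * s \<le> norm (pole s - 1)"
    using Im_pole_ge[OF assms(1,2)] abs_Im_le_cmod[of "pole s - 1"] by simp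
  also have "\<dots> \<le> norm (pole s - z) + norm (pole s' - z) + norm (pole s' - 1)"
    using dist_triangle[of "pole s" 1 z] dist_triangle[of z 1 "pole s'"] by (simp add: dist_norm norm_minus_commute)
  finally show False using near near' norm_pole_minus_1_le[of s'] assms by simp
qed

section \<open>The outer function\<close>

text \<open>
  \<open>K\<close> is the set of scales and \<open>m\<close> their masses. The constant \<open>1/2\<close> in the exponent normalises the value
  at the origin; it is the gain of \<open>m s / 2\<close> per scale that makes the function small on the circle.
\<close>

definition outer :: "real set \<Rightarrow> (real \<Rightarrow> real) \<Rightarrow> real \<Rightarrow> nat set \<Rightarrow> (nat \<Rightarrow> real) \<Rightarrow> complex \<Rightarrow> complex" where
  "outer K m R F c z =
     exp (\<Sum>s\<in>K. of_real (m s) * (herglotz (pole s) z - herglotz (of_real (1 + s)) z / 2 - 1 / 2)) *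
     (\<Prod>\<gamma>\<in>F. (damping R (c \<gamma>) z / damping R (c \<gamma>) 0)\<^sup>2)"

lemma pole_nonzero: "s \<ge> 0 \<Longrightarrow> pole s \<noteq> 0"
  using norm_pole[of s] by (metis add_pos_nonneg divide_nonneg_pos norm_zero order_less_irrefl zero_less_numeral zero_less_one)

lemma damping_0_nonzero: "R \<ge> 1 \<Longrightarrow> c \<ge> 0 \<Longrightarrow> damping R c 0 \<noteq> 0"
  by (auto simp: damping_def simp flip: of_real_add)

lemma outer_0:
  assumes "\<And>s. s \<in> K \<Longrightarrow> s > 0" "R \<ge> 1" "\<And>\<gamma>. c \<gamma> \<ge> 0"
  shows "outer K m R F c 0 = 1"
proof -
  have "herglotz (pole s) 0 = 1" "herglotz (of_real (1 + s)) 0 = 1" if "s \<in> K" for s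
    using assms(1)[OF that] pole_nonzero[of s] by (auto intro!: herglotz_0 simp del: of_real_add)
  then have "(\<Sum>s\<in>K. of_real (m s) * (herglotz (pole s) 0 - herglotz (of_real (1 + s)) 0 / 2 - 1 / 2)) = 0"
    by (intro sum.neutral) (simp del: of_real_add)
  moreover have "(\<Prod>\<gamma>\<in>F. (damping R (c \<gamma>) 0 / damping R (c \<gamma>) 0)\<^sup>2) = 1"
    using damping_0_nonzero assms by (intro prod.neutral) auto
  ultimately show ?thesis unfolding outer_def by (simp only: exp_zero mult_1)
qed

lemma holomorphic_outer:
  assumes "\<And>s. s \<in> K \<Longrightarrow> pole s \<notin> S" "\<And>s. s \<in> K \<Longrightarrow> of_real (1 + s) \<notin> S"
    and "\<And>\<gamma>. \<gamma> \<in> F \<Longrightarrow> of_real (R + c \<gamma>) \<notin> S" "R \<ge> 1" "\<And>\<gamma>. c \<gamma> \<ge> 0"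
  shows "outer K m R F c holomorphic_on S"
  unfolding outer_def[abs_def] herglotz_def[abs_def] damping_def[of _ _ z for z]
  using assms damping_0_nonzero
  by (intro holomorphic_intros) (auto simp del: of_real_add)

lemma norm_damping_quotient_le:
  assumes "Re z < R" "R \<ge> 1" "c \<ge> 0"
  shows "norm ((damping R c z / damping R c 0)\<^sup>2) \<le> (1 + c)\<^sup>2 / (1 + c\<^sup>2 / (norm (of_real R - z))\<^sup>2)"
proof -
  have "norm ((damping R c z / damping R c 0)\<^sup>2) = (norm (damping R c z))\<^sup>2 / (norm (damping R c 0))\<^sup>2"
    by (simp add: norm_power norm_divide power_divide)
  also have "\<dots> \<le> (1 / (1 + c\<^sup>2 / (norm (of_real R - z))\<^sup>2)) / (1 / (1 + c))\<^sup>2"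
    using assms norm_damping_square_le norm_damping_0 by (intro frac_le power_mono) auto
  finally show ?thesis by (simp add: power_divide)
qed

text \<open>
  The total price of the damping factors is \<open>\<Prod> (1 + c \<gamma>)\<^sup>2 \<le> exp (2 \<Sum> c \<gamma>)\<close>, and it is linear in \<open>c\<close>,
  whereas the factors absorbed are quadratic in \<open>c\<close>.
\<close>

lemma norm_damping_product_le:
  assumes "Re z < R" "R \<ge> 1" "\<And>\<gamma>. c \<gamma> \<ge> 0"
  shows "norm (\<Prod>\<gamma>\<in>F. (damping R (c \<gamma>) z / damping R (c \<gamma>) 0)\<^sup>2) * (\<Prod>\<gamma>\<in>F. 1 + (c \<gamma>)\<^sup>2 / (norm (of_real R - z))\<^sup>2)
     \<le> exp (2 * (\<Sum>\<gamma>\<in>F. c \<gamma>))"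
proof -
  let ?g = "\<lambda>\<gamma>. 1 + (c \<gamma>)\<^sup>2 / (norm (of_real R - z))\<^sup>2"
  have g: "?g \<gamma> > 0" for \<gamma> by (simp add: add_pos_nonneg)
  have "norm (\<Prod>\<gamma>\<in>F. (damping R (c \<gamma>) z / damping R (c \<gamma>) 0)\<^sup>2) * (\<Prod>\<gamma>\<in>F. ?g \<gamma>)
     = (\<Prod>\<gamma>\<in>F. norm ((damping R (c \<gamma>) z / damping R (c \<gamma>) 0)\<^sup>2) * ?g \<gamma>)"
    by (simp add: prod_norm prod.distrib)
  also have "\<dots> \<le> (\<Prod>\<gamma>\<in>F. (exp (c \<gamma>))\<^sup>2)"
  proof (intro prod_mono conjI)
    fix \<gamma>
    have "norm ((damping R (c \<gamma>) z / damping R (c \<gamma>) 0)\<^sup>2) * ?g \<gamma> \<le> ((1 + c \<gamma>)\<^sup>2 / ?g \<gamma>) * ?g \<gamma>"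
      using assms g[of \<gamma>] by (intro mult_right_mono norm_damping_quotient_le) auto
    also have "\<dots> = (1 + c \<gamma>)\<^sup>2" using g[of \<gamma>] by simp
    also have "\<dots> \<le> (exp (c \<gamma>))\<^sup>2" using assms(3)[of \<gamma>] by (intro power_mono) auto
    finally show "norm ((damping R (c \<gamma>) z / damping R (c \<gamma>) 0)\<^sup>2) * ?g \<gamma> \<le> (exp (c \<gamma>))\<^sup>2" .
    show "0 \<le> norm ((damping R (c \<gamma>) z / damping R (c \<gamma>) 0)\<^sup>2) * ?g \<gamma>" using g[of \<gamma>] by simp
  qed
  also have "\<dots> \<le> exp (2 * (\<Sum>\<gamma>\<in>F. c \<gamma>))"
    by (cases "finite F") (simp_all add: exp_sum sum_distrib_left exp_double)
  finally show ?thesis .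
qed

lemma norm_outer_mult_majorant_le:
  assumes "norm z = 1" "R > 1" "\<And>\<gamma>. c \<gamma> \<ge> 0"
  shows "norm (outer K m R F c z) * (\<Prod>\<gamma>\<in>F. 1 + (c \<gamma>)\<^sup>2 / (norm (of_real R - z))\<^sup>2)
    \<le> exp ((\<Sum>s\<in>K. m s * (Re (herglotz (pole s) z) - Re (herglotz (of_real (1 + s)) z) / 2)) - (\<Sum>s\<in>K. m s) / 2
        + 2 * (\<Sum>\<gamma>\<in>F. c \<gamma>))"
proof -
  let ?E = "(\<Sum>s\<in>K. of_real (m s) * (herglotz (pole s) z - herglotz (of_real (1 + s)) z / 2 - 1 / 2))"
  have "Re ?E = (\<Sum>s\<in>K. m s * (Re (herglotz (pole s) z) - Re (herglotz (of_real (1 + s)) z) / 2)) - (\<Sum>s\<in>K. m s) / 2"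
    unfolding Re_sum sum_divide_distrib sum_subtractf[symmetric]
    by (intro sum.cong refl) (simp add: algebra_simps del: of_real_add)
  moreover have "Re z < R" using assms complex_Re_le_cmod[of z] by linarith
  then have "norm (\<Prod>\<gamma>\<in>F. (damping R (c \<gamma>) z / damping R (c \<gamma>) 0)\<^sup>2) * (\<Prod>\<gamma>\<in>F. 1 + (c \<gamma>)\<^sup>2 / (norm (of_real R - z))\<^sup>2)
     \<le> exp (2 * (\<Sum>\<gamma>\<in>F. c \<gamma>))"
    using assms by (intro norm_damping_product_le) auto
  then have "exp (Re ?E) * (norm (\<Prod>\<gamma>\<in>F. (damping R (c \<gamma>) z / damping R (c \<gamma>) 0)\<^sup>2) * (\<Prod>\<gamma>\<in>F. 1 + (c \<gamma>)\<^sup>2 / (norm (of_real R - z))\<^sup>2))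
     \<le> exp (Re ?E) * exp (2 * (\<Sum>\<gamma>\<in>F. c \<gamma>))" by (intro mult_left_mono) auto
  ultimately show ?thesis unfolding outer_def norm_mult norm_exp_eq_Re by (simp add: exp_add mult.assoc)
qed

text \<open>
  All poles of the outer function are at least as far from \<open>z\<close>, up to a constant, as \<open>R\<close> is. Thus the distance to
  \<open>R\<close> is the natural unit of length at \<open>z\<close>.
\<close>

lemma circle_distances_to_poles:
  assumes "norm z = 1" "R \<ge> 1" "0 < s" "R - 1 \<le> s"
  shows "norm (of_real R - z) \<le> 402 * norm (pole s - z)"
    and "norm (of_real R - z) \<le> norm (of_real (1 + s) - z)"
proof -
  have "norm (of_real R - z) \<le> norm (of_real (R - 1) :: complex) + norm (pole s - 1) + norm (pole s - z)"
    using dist_triangle[of "of_real R" z 1] dist_triangle[of 1 z "pole s"]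
    by (simp add: dist_norm norm_minus_commute)
  also have "\<dots> \<le> s + (s + s / 200) + norm (pole s - z)"
    using norm_pole_minus_1_le[of s] assms by (simp del: of_real_diff)
  also have "\<dots> \<le> 402 * norm (pole s - z)"
    using norm_pole_minus_circle_ge[of s z] assms by simp
  finally show "norm (of_real R - z) \<le> 402 * norm (pole s - z)" .
  have "Re z \<le> R" using complex_Re_le_cmod[of z] assms by linarith
  then show "norm (of_real R - z) \<le> norm (of_real (1 + s) - z)"
    using norm_shift_mono[of z R "1 + s - R"] assms by simp
qed

text \<open>
  The logarithmic derivative of the outer function is \<open>O(1/\<tau>\<^sup>2)\<close> in the disc of radius \<open>\<tau>/1000\<close> around
  \<open>z\<close>, where \<open>\<tau> = |R - z|\<close>, because every kernel and every damping factor contributes the inverse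
  square of the distance to its poles and zeros.
\<close>

lemma norm_outer_ratio_le:
  assumes z: "norm z = 1" "R > 1" "\<And>\<gamma>. c \<gamma> \<ge> 0"
    and K: "\<And>s. s \<in> K \<Longrightarrow> 0 < s \<and> s \<le> 1 / 4 \<and> R - 1 \<le> s" "\<And>s. s \<in> K \<Longrightarrow> m s \<ge> 0"
    and near: "norm (z' - z) \<le> norm (of_real R - z) / 1000"
  shows "norm (outer K m R F c z') \<le> norm (outer K m R F c z) *
    exp ((2 * 10 ^ 6 * (\<Sum>s\<in>K. m s) + 4 * (\<Sum>\<gamma>\<in>F. c \<gamma>)) * norm (z' - z) / (norm (of_real R - z))\<^sup>2)"
proof -
  define \<tau> where "\<tau> = norm (of_real R - z)"
  let ?\<delta> = "norm (z' - z)"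
  define E where "E x = (\<Sum>s\<in>K. of_real (m s) * (herglotz (pole s) x - herglotz (of_real (1 + s)) x / 2 - 1 / 2))" for x
  define P where "P x = (\<Prod>\<gamma>\<in>F. (damping R (c \<gamma>) x / damping R (c \<gamma>) 0)\<^sup>2)" for x
  have outer: "outer K m R F c x = exp (E x) * P x" for x by (simp add: outer_def E_def P_def)
  have Rez: "Re z < R" using z complex_Re_le_cmod[of z] by linarith
  then have \<tau>: "\<tau> > 0" by (auto simp: \<tau>_def)
  have "norm (E z' - E z) \<le> (\<Sum>s\<in>K. m s * (2 * 10 ^ 6 * ?\<delta> / \<tau>\<^sup>2))"
  proof -
    have "norm (E z' - E z) = norm (\<Sum>s\<in>K. of_real (m s) * ((herglotz (pole s) z' - herglotz (pole s) z)
        - (herglotz (of_real (1 + s)) z' - herglotz (of_real (1 + s)) z) / 2))"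
      unfolding E_def sum_subtractf[symmetric]
      by (intro arg_cong[of _ _ norm] sum.cong refl) (simp add: algebra_simps diff_divide_distrib del: of_real_add)
    also have "\<dots> \<le> (\<Sum>s\<in>K. m s * (2 * 10 ^ 6 * ?\<delta> / \<tau>\<^sup>2))"
    proof (rule sum_norm_le)
      fix s assume s: "s \<in> K"
      have d: "\<tau> / 402 \<le> norm (pole s - z)" "\<tau> / 402 \<le> norm (of_real (1 + s) - z)"
      proof -
        have "\<tau> \<le> 402 * norm (pole s - z)" "\<tau> \<le> norm (of_real (1 + s) - z)"
          using circle_distances_to_poles[of z R s] z K(1)[OF s] unfolding \<tau>_def by auto
        then show "\<tau> / 402 \<le> norm (pole s - z)" "\<tau> / 402 \<le> norm (of_real (1 + s) - z)"
          using \<tau> by linarith+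
      qed
      have "norm (herglotz (pole s) z' - herglotz (pole s) z) \<le> 8 * ?\<delta> / (\<tau> / 402)\<^sup>2"
        using K(1)[OF s] d near \<tau> unfolding \<tau>_def[symmetric]
        by (intro norm_herglotz_diff_le) (auto simp: norm_pole)
      moreover have "norm (herglotz (of_real (1 + s)) z' - herglotz (of_real (1 + s)) z) \<le> 8 * ?\<delta> / (\<tau> / 402)\<^sup>2"
      proof (rule norm_herglotz_diff_le)
        show "norm (of_real (1 + s) :: complex) \<le> 2" using K(1)[OF s] unfolding norm_of_real by auto
      qed (use d near \<tau> in \<open>auto simp: \<tau>_def[symmetric] simp del: of_real_add\<close>)
      ultimately have "norm ((herglotz (pole s) z' - herglotz (pole s) z)
        - (herglotz (of_real (1 + s)) z' - herglotz (of_real (1 + s)) z) / 2) \<le> 8 * ?\<delta> / (\<tau> / 402)\<^sup>2 + (8 * ?\<delta> / (\<tau> / 402)\<^sup>2) / 2"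
        by (intro order_trans[OF norm_triangle_ineq4 add_mono]) (simp_all add: norm_divide del: of_real_add)
      \<comment> \<open>\<open>1939248 = 12 \<cdot> 402\<^sup>2\<close>, with \<open>402\<close> from the comparison of distances\<close>
      also have "\<dots> = 1939248 * ?\<delta> / \<tau>\<^sup>2" by (simp add: power_divide)
      also have "\<dots> \<le> 2 * 10 ^ 6 * ?\<delta> / \<tau>\<^sup>2" by (intro divide_right_mono mult_right_mono) auto
      finally have "m s * norm ((herglotz (pole s) z' - herglotz (pole s) z)
        - (herglotz (of_real (1 + s)) z' - herglotz (of_real (1 + s)) z) / 2) \<le> m s * (2 * 10 ^ 6 * ?\<delta> / \<tau>\<^sup>2)"
        by (rule mult_left_mono) (rule K(2)[OF s])
      then show "norm (of_real (m s) * ((herglotz (pole s) z' - herglotz (pole s) z)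
        - (herglotz (of_real (1 + s)) z' - herglotz (of_real (1 + s)) z) / 2)) \<le> m s * (2 * 10 ^ 6 * ?\<delta> / \<tau>\<^sup>2)"
        unfolding norm_mult norm_of_real abs_of_nonneg[OF K(2)[OF s]] .
    qed
    finally show ?thesis .
  qed
  also have "\<dots> = 2 * 10 ^ 6 * (\<Sum>s\<in>K. m s) * ?\<delta> / \<tau>\<^sup>2"
    unfolding sum_distrib_right[symmetric] by simp
  finally have "Re (E z') \<le> Re (E z) + 2 * 10 ^ 6 * (\<Sum>s\<in>K. m s) * ?\<delta> / \<tau>\<^sup>2"
    using complex_Re_le_cmod[of "E z' - E z"] by simp
  then have exp_part: "norm (exp (E z')) \<le> norm (exp (E z)) * exp (2 * 10 ^ 6 * (\<Sum>s\<in>K. m s) * ?\<delta> / \<tau>\<^sup>2)"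
    by (simp flip: exp_add)
  have "norm (P z') \<le> (\<Prod>\<gamma>\<in>F. norm ((damping R (c \<gamma>) z / damping R (c \<gamma>) 0)\<^sup>2) * exp (c \<gamma> * (4 * ?\<delta> / \<tau>\<^sup>2)))"
    unfolding P_def prod_norm[symmetric]
  proof (intro prod_mono conjI)
    fix \<gamma>
    have "norm (damping R (c \<gamma>) z') \<le> norm (damping R (c \<gamma>) z) * exp (2 * c \<gamma> * ?\<delta> / \<tau>\<^sup>2)"
      using Rez z near \<tau> unfolding \<tau>_def[symmetric]
      by (subst \<tau>_def, intro norm_damping_ratio_le) (auto simp: \<tau>_def[symmetric])
    then have "(norm (damping R (c \<gamma>) z') / norm (damping R (c \<gamma>) 0))\<^sup>2
      \<le> (norm (damping R (c \<gamma>) z) * exp (2 * c \<gamma> * ?\<delta> / \<tau>\<^sup>2) / norm (damping R (c \<gamma>) 0))\<^sup>2"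
      by (intro power_mono divide_right_mono) auto
    also have "\<dots> = (norm (damping R (c \<gamma>) z) / norm (damping R (c \<gamma>) 0))\<^sup>2 * (exp (2 * c \<gamma> * ?\<delta> / \<tau>\<^sup>2))\<^sup>2"
      by (simp add: power_mult_distrib power_divide)
    also have "(exp (2 * c \<gamma> * ?\<delta> / \<tau>\<^sup>2))\<^sup>2 = exp (c \<gamma> * (4 * ?\<delta> / \<tau>\<^sup>2))"
      by (simp add: exp_double[symmetric] mult_ac)
    finally show "norm ((damping R (c \<gamma>) z' / damping R (c \<gamma>) 0)\<^sup>2) \<le>
       norm ((damping R (c \<gamma>) z / damping R (c \<gamma>) 0)\<^sup>2) * exp (c \<gamma> * (4 * ?\<delta> / \<tau>\<^sup>2))"
      by (simp add: norm_power norm_divide)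
  qed auto
  also have "\<dots> = norm (P z) * (\<Prod>\<gamma>\<in>F. exp (c \<gamma> * (4 * ?\<delta> / \<tau>\<^sup>2)))"
    by (simp add: P_def prod.distrib prod_norm)
  also have "(\<Prod>\<gamma>\<in>F. exp (c \<gamma> * (4 * ?\<delta> / \<tau>\<^sup>2))) = exp (4 * (\<Sum>\<gamma>\<in>F. c \<gamma>) * ?\<delta> / \<tau>\<^sup>2)"
  proof -
    have "(\<Prod>\<gamma>\<in>F. exp (c \<gamma> * (4 * ?\<delta> / \<tau>\<^sup>2))) = exp (\<Sum>\<gamma>\<in>F. c \<gamma> * (4 * ?\<delta> / \<tau>\<^sup>2))"
      by (cases "finite F") (simp_all add: exp_sum)
    then show ?thesis by (simp only: sum_distrib_right[symmetric]) simp
  qed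
  finally have prod_part: "norm (P z') \<le> norm (P z) * exp (4 * (\<Sum>\<gamma>\<in>F. c \<gamma>) * ?\<delta> / \<tau>\<^sup>2)" .
  have "norm (outer K m R F c z') \<le> (norm (exp (E z)) * exp (2 * 10 ^ 6 * (\<Sum>s\<in>K. m s) * ?\<delta> / \<tau>\<^sup>2))
      * (norm (P z) * exp (4 * (\<Sum>\<gamma>\<in>F. c \<gamma>) * ?\<delta> / \<tau>\<^sup>2))"
    unfolding outer norm_mult by (intro mult_mono exp_part prod_part) auto
  also have "\<dots> = norm (outer K m R F c z) *
    exp ((2 * 10 ^ 6 * (\<Sum>s\<in>K. m s) + 4 * (\<Sum>\<gamma>\<in>F. c \<gamma>)) * ?\<delta> / \<tau>\<^sup>2)"
    unfolding outer norm_mult by (simp add: exp_add add_divide_distrib distrib_right)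
  finally show ?thesis unfolding \<tau>_def .
qed

text \<open>
  A bound beyond the unit disc that depends on the frequencies only through the sum of the \<open>c \<gamma>\<close>. It makes the
  Taylor remainders uniformly small for all finite parts of the set of frequencies.
\<close>

lemma outer_bounded:
  assumes "finite K" "0 < \<eta>" "\<And>s. s \<in> K \<Longrightarrow> \<eta> < s / 200" "1 + \<eta> < R"
  obtains B where "B > 0"
    "\<And>F c z. (\<And>\<gamma>. c \<gamma> \<ge> 0) \<Longrightarrow> norm z \<le> 1 + \<eta> \<Longrightarrow> norm (outer K m R F c z) \<le> B * exp (2 * (\<Sum>\<gamma>\<in>F. c \<gamma>))"
proof -
  let ?e = "\<lambda>z. exp (\<Sum>s\<in>K. of_real (m s) * (herglotz (pole s) z - herglotz (of_real (1 + s)) z / 2 - 1 / 2))"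
  have ne: "pole s \<noteq> z" "of_real (1 + s) \<noteq> z" if "s \<in> K" "norm z \<le> 1 + \<eta>" for s z
  proof -
    have s: "s > 200 * \<eta>" using assms(3)[OF that(1)] by simp
    then show "pole s \<noteq> z" using norm_pole[of s] assms(2) that(2) by auto
    have "norm (of_real (1 + s) :: complex) = 1 + s" using s assms(2) unfolding norm_of_real by auto
    then show "of_real (1 + s) \<noteq> z" using s assms(2) that(2) by auto
  qed
  have "continuous_on (cball 0 (1 + \<eta>)) ?e"
    unfolding herglotz_def using ne by (intro continuous_intros) (auto simp del: of_real_add)
  then have "compact (?e ` cball 0 (1 + \<eta>))" by (intro compact_continuous_image) auto
  then obtain B where B: "B > 0" "\<And>z. norm z \<le> 1 + \<eta> \<Longrightarrow> norm (?e z) \<le> B"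
    using bounded_pos[of "?e ` cball 0 (1 + \<eta>)"] compact_imp_bounded by auto
  have "norm (outer K m R F c z) \<le> B * exp (2 * (\<Sum>\<gamma>\<in>F. c \<gamma>))"
    if c: "\<And>\<gamma>. c \<gamma> \<ge> 0" and z: "norm z \<le> 1 + \<eta>" for F c z
  proof -
    let ?P = "norm (\<Prod>\<gamma>\<in>F. (damping R (c \<gamma>) z / damping R (c \<gamma>) 0)\<^sup>2)"
    have "Re z < R" "R \<ge> 1" using z assms complex_Re_le_cmod[of z] by linarith+
    note le = norm_damping_product_le[OF this, of c F, OF c]
    have "1 \<le> (\<Prod>\<gamma>\<in>F. 1 + (c \<gamma>)\<^sup>2 / (norm (of_real R - z))\<^sup>2)" by (intro prod_ge_1) auto
    then have "?P * 1 \<le> ?P * (\<Prod>\<gamma>\<in>F. 1 + (c \<gamma>)\<^sup>2 / (norm (of_real R - z))\<^sup>2)" by (intro mult_left_mono) auto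
    then have "?P \<le> exp (2 * (\<Sum>\<gamma>\<in>F. c \<gamma>))" using le by linarith
    then show ?thesis unfolding outer_def norm_mult using B z by (intro mult_mono) auto
  qed
  then show ?thesis using B(1) that by blast
qed

section \<open>Masses read off from the weight\<close>

definition depth :: "(real \<Rightarrow> real) \<Rightarrow> real \<Rightarrow> real" where
  "depth w t = max 0 (- ln (w t))"

text \<open>
  At each point of the circle at most one scale contributes a positive term. Its kernel is at most \<open>600/s\<close>, so
  the factor \<open>1/1200\<close> in the masses leaves half of the depth at \<open>s/2\<close>, and \<open>w\<close> increases.
\<close>

lemma sum_pole_kernels_le:
  fixes w :: "real \<Rightarrow> real"
  assumes "finite K" and K: "\<And>s. s \<in> K \<Longrightarrow> 0 < s \<and> s \<le> 1 / 4"
    and gaps: "\<And>s s'. s \<in> K \<Longrightarrow> s' \<in> K \<Longrightarrow> s' < s \<Longrightarrow> s' \<le> s / 4"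
    and m: "\<And>s. s \<in> K \<Longrightarrow> 0 \<le> m s \<and> m s \<le> s * depth w (s / 2) / 1200"
    and w: "\<And>t. t \<in> {0<..<1} \<Longrightarrow> w t > 0" "mono_on {0<..<1} w" and t: "0 < t" "t < 1"
  defines "z \<equiv> cis (2 * pi * t)"
  shows "(\<Sum>s\<in>K. m s * (Re (herglotz (pole s) z) - Re (herglotz (of_real (1 + s)) z) / 2)) \<le> depth w t / 2"
proof -
  let ?h = "\<lambda>s. m s * (Re (herglotz (pole s) z) - Re (herglotz (of_real (1 + s)) z) / 2)"
  have z: "norm z = 1" by (simp add: z_def)
  have far: "?h s \<le> 0" if "s \<in> K" "s / 4 \<le> norm (pole s - z)" for s
    using Re_herglotz_pole_dominated[of s z] K[OF that(1)] m[OF that(1)] z that(2)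
    by (intro mult_nonneg_nonpos) auto
  show ?thesis
  proof (cases "\<exists>s\<in>K. norm (pole s - z) < s / 4")
    case False
    then have "sum ?h K \<le> 0" using far by (intro sum_nonpos) (auto simp: not_less)
    then show ?thesis by (simp add: depth_def del: of_real_add)
  next
    case True
    then obtain s where s: "s \<in> K" "norm (pole s - z) < s / 4" by blast
    note Ks = K[OF s(1)]
    have other: "s' / 4 \<le> norm (pole s' - z)" if "s' \<in> K - {s}" for s'
    proof (rule ccontr)
      assume "\<not> s' / 4 \<le> norm (pole s' - z)"
      then have near: "norm (pole s' - z) < s' / 4" by simp
      have "s' < s \<or> s < s'" "s' \<in> K" using that by auto
      then show False
        using near_pole_unique[of s s' z] near_pole_unique[of s' s z] gaps[of s s'] gaps[of s' s] near s K[of s'] Ks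
        by auto
    qed
    have "sum ?h K = ?h s + sum ?h (K - {s})" using assms(1) s(1) by (rule sum.remove)
    also have "\<dots> \<le> ?h s + 0" using far other by (intro add_left_mono sum_nonpos) auto
    also have "?h s \<le> m s * (600 / s)"
    proof (intro mult_left_mono)
      have "norm (of_real (1 + s) :: complex) = 1 + s" using Ks unfolding norm_of_real by auto
      then have "Re (herglotz (of_real (1 + s)) z) \<ge> 0"
        using Ks unfolding Re_herglotz_circle[OF z] by (auto simp: power2_eq_square algebra_simps simp del: of_real_add)
      then show "Re (herglotz (pole s) z) - Re (herglotz (of_real (1 + s)) z) / 2 \<le> 600 / s"
        using Re_herglotz_pole_le[of s z] Ks z by simp
    qed (use m s in auto)
    also have "\<dots> \<le> (s * depth w (s / 2) / 1200) * (600 / s)"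
      using m[OF s(1)] Ks by (intro mult_right_mono) auto
    also have "\<dots> = depth w (s / 2) / 2" using Ks by simp
    also have "depth w (s / 2) \<le> depth w t"
    proof -
      have "t \<le> s / 2" using s(2) Ks t unfolding z_def by (intro near_pole_position) auto
      then have "w t \<le> w (s / 2)" using Ks t by (intro mono_onD[OF w(2)]) auto
      then have "ln (w t) \<le> ln (w (s / 2))" using w(1)[of t] t by simp
      then show ?thesis by (simp add: depth_def)
    qed
    finally show ?thesis by (simp del: of_real_add)
  qed
qed

lemma exp_depth_mult_le: "w t > 0 \<Longrightarrow> exp (depth w t) * w t \<le> max 1 (w t)"
  by (auto simp: depth_def max_def exp_minus)


text \<open>
  On the interval between \<open>(1/4)\<^bsup>k+1\<^esup>/2\<close> and \<open>(1/4)\<^sup>k/2\<close> the depth of an increasing weight is at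
  most its value at the left endpoint. If the sums were bounded, the negative part of \<open>log w\<close> would be integrable.
\<close>

lemma depth_sum_unbounded:
  fixes w :: "real \<Rightarrow> real"
  assumes w: "\<And>t. t \<in> {0<..<1} \<Longrightarrow> w t > 0" "mono_on {0<..<1} w"
    and inf: "ext_integral (\<lambda>t. ln (w t)) = -\<infinity>"
  shows "\<exists>K. finite K \<and> K \<subseteq> range (\<lambda>k. (1 / 4) ^ Suc k) \<and> C \<le> (\<Sum>s\<in>K. s * depth w (s / 2))"
proof (rule ccontr)
  define \<sigma> where "\<sigma> k = (1 / 4 :: real) ^ k" for k :: nat
  have \<sigma>: "\<sigma> k > 0" "\<sigma> k \<le> 1" "\<sigma> (Suc k) = \<sigma> k / 4" for k by (auto simp: \<sigma>_def power_le_one)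
  have depth_nonneg: "depth w t \<ge> 0" for t by (simp add: depth_def)
  assume "\<not> ?thesis"
  then have bounded: "(\<Sum>s\<in>K. s * depth w (s / 2)) < C" if "finite K" "K \<subseteq> range (\<lambda>k. (1 / 4) ^ Suc k)" for K
    using that by (force simp: not_le)
  have "inj \<sigma>" by (auto simp: inj_def \<sigma>_def power_inject_exp')
  have part: "(\<Sum>k<n. \<sigma> (Suc k) * depth w (\<sigma> (Suc k) / 2)) < C" for n
  proof -
    have "inj_on (\<lambda>k. \<sigma> (Suc k)) {..<n}" using \<open>inj \<sigma>\<close> by (auto simp: inj_def inj_on_def)
    then have "(\<Sum>k<n. \<sigma> (Suc k) * depth w (\<sigma> (Suc k) / 2)) = (\<Sum>s\<in>(\<lambda>k. \<sigma> (Suc k)) ` {..<n}. s * depth w (s / 2))"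
      by (simp add: sum.reindex)
    also have "\<dots> < C" by (intro bounded) (auto simp: \<sigma>_def)
    finally show ?thesis .
  qed
  define I where "I k = {\<sigma> (Suc k) / 2<..\<sigma> k / 2}" for k
  have I_sub: "I k \<subseteq> {0..1}" for k
  proof
    fix t assume "t \<in> I k"
    then show "t \<in> {0..1}" using \<sigma>(1)[of "Suc k"] \<sigma>(2)[of k] unfolding I_def by simp
  qed
  have "(\<integral>\<^sup>+ t. ennreal (- ln (w t)) \<partial>circle) \<le>
    (\<integral>\<^sup>+ t. (\<Sum>k. ennreal (depth w (\<sigma> (Suc k) / 2)) * indicator (I k) t) + ennreal (depth w (1 / 2)) \<partial>circle)"
  proof (rule nn_integral_mono_AE)
    have "{0, 1 :: real} \<in> null_sets lebesgue" by (simp add: negligible_iff_null_sets[symmetric])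
    from AE_not_in[OF this] have "AE t::real in lebesgue. t \<in> {0..1} \<longrightarrow> t \<noteq> 0 \<and> t \<noteq> 1"
      by (rule eventually_mono) auto
    then have "AE t in circle. t \<noteq> 0 \<and> t \<noteq> 1"
      by (subst AE_restrict_space_iff) simp_all
    moreover have "AE t in circle. t \<in> {0..1}" by (intro AE_I2) simp
    ultimately show "AE t in circle. ennreal (- ln (w t)) \<le> (\<Sum>k. ennreal (depth w (\<sigma> (Suc k) / 2)) * indicator (I k) t) + ennreal (depth w (1 / 2))"
    proof eventually_elim
      case (elim t)
      then have t: "0 < t" "t < 1" by auto
      have key: "ennreal (- ln (w t)) \<le> ennreal (depth w u)" if "0 < u" "u \<le> t" for u
      proof -
        have "w u \<le> w t" using that t by (intro mono_onD[OF w(2)]) auto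
        then have "ln (w u) \<le> ln (w t)" using w(1)[of t] w(1)[of u] that t by simp
        then show ?thesis by (intro ennreal_leI) (simp add: depth_def)
      qed
      show ?case
      proof (cases "t \<le> 1 / 2")
        case False
        then have "ennreal (- ln (w t)) \<le> ennreal (depth w (1 / 2))" by (intro key) auto
        then show ?thesis by (simp add: add_increasing)
      next
        case True
        obtain n where "(1 / 4 :: real) ^ n < 2 * t"
          using real_arch_pow_inv[of "2 * t" "1 / 4"] t by auto
        then have "\<exists>k. \<sigma> k / 2 < t" by (intro exI[of _ n]) (simp add: \<sigma>_def)
        define k where "k = (LEAST k. \<sigma> k / 2 < t)"
        have k: "\<sigma> k / 2 < t" unfolding k_def using \<open>\<exists>k. \<sigma> k / 2 < t\<close> by (rule LeastI_ex)
        have "k \<noteq> 0"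
        proof
          assume "k = 0"
          then have "\<sigma> k = 1" by (simp add: \<sigma>_def)
          with k True show False by simp
        qed
        then obtain j where j: "k = Suc j" by (cases k) auto
        have "\<not> \<sigma> j / 2 < t" using not_less_Least[of j "\<lambda>k. \<sigma> k / 2 < t"] j by (simp add: k_def)
        then have "t \<in> I j" using k j by (simp add: I_def)
        define f where "f k = ennreal (depth w (\<sigma> (Suc k) / 2)) * indicator (I k) t" for k
        have "ennreal (- ln (w t)) \<le> f j" unfolding f_def using \<open>t \<in> I j\<close> k j \<sigma>(1)[of "Suc j"] by (simp add: key)
        also have "\<dots> \<le> (\<Sum>k. f k)" using sum_le_suminf[of f "{j}"] by simp
        finally show ?thesis unfolding f_def by (simp add: add_increasing2)
      qed
    qed
  qed
  also have "\<dots> = (\<Sum>k. \<integral>\<^sup>+ t. ennreal (depth w (\<sigma> (Suc k) / 2)) * indicator (I k) t \<partial>circle) + (\<integral>\<^sup>+ t. ennreal (depth w (1 / 2)) \<partial>circle)"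
  proof -
    have [measurable]: "I k \<in> sets circle" for k using I_sub[of k] by (auto simp: I_def sets_restrict_space_iff)
    show ?thesis by (subst nn_integral_suminf[symmetric], measurable) (rule nn_integral_add; measurable)
  qed
  also have "(\<integral>\<^sup>+ t. ennreal (depth w (1 / 2)) \<partial>circle) = ennreal (depth w (1 / 2))"
    by (simp add: emeasure_restrict_space)
  also have "(\<lambda>k. \<integral>\<^sup>+ t. ennreal (depth w (\<sigma> (Suc k) / 2)) * indicator (I k) t \<partial>circle) =
     (\<lambda>k. ennreal (3 / 2 * (\<sigma> (Suc k) * depth w (\<sigma> (Suc k) / 2))))"
  proof
    fix k
    note sub = I_sub[of k]
    then have "emeasure circle (I k) = emeasure lebesgue (I k)"
      by (intro emeasure_restrict_space) auto
    also have "\<dots> = ennreal (\<sigma> k / 2 - \<sigma> (Suc k) / 2)" unfolding I_def using \<sigma>[of k] by simp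
    finally have e: "emeasure circle (I k) = ennreal (3 / 2 * \<sigma> (Suc k))" by (simp add: \<sigma>(3))
    have "(\<integral>\<^sup>+ t. ennreal (depth w (\<sigma> (Suc k) / 2)) * indicator (I k) t \<partial>circle) = ennreal (depth w (\<sigma> (Suc k) / 2)) * emeasure circle (I k)"
      using sub by (intro nn_integral_cmult_indicator) (auto simp: I_def sets_restrict_space_iff)
    then show "(\<integral>\<^sup>+ t. ennreal (depth w (\<sigma> (Suc k) / 2)) * indicator (I k) t \<partial>circle) = ennreal (3 / 2 * (\<sigma> (Suc k) * depth w (\<sigma> (Suc k) / 2)))"
      using depth_nonneg less_imp_le[OF \<sigma>(1)[of "Suc k"]] unfolding e by (simp add: ennreal_mult[symmetric] mult_ac)
  qed
  finally have le: "(\<integral>\<^sup>+ t. ennreal (- ln (w t)) \<partial>circle) \<le>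
    (\<Sum>k. ennreal (3 / 2 * (\<sigma> (Suc k) * depth w (\<sigma> (Suc k) / 2)))) + ennreal (depth w (1 / 2))" .
  have "(\<Sum>k. ennreal (3 / 2 * (\<sigma> (Suc k) * depth w (\<sigma> (Suc k) / 2)))) \<le> ennreal (3 / 2 * C)"
  proof (rule suminf_le_const)
    fix n
    have "(\<Sum>k<n. ennreal (3 / 2 * (\<sigma> (Suc k) * depth w (\<sigma> (Suc k) / 2)))) = ennreal (\<Sum>k<n. 3 / 2 * (\<sigma> (Suc k) * depth w (\<sigma> (Suc k) / 2)))"
      using depth_nonneg less_imp_le[OF \<sigma>(1)] by (intro sum_ennreal) auto
    also have "\<dots> \<le> ennreal (3 / 2 * C)"
    proof (rule ennreal_leI)
      have "(\<Sum>k<n. 3 / 2 * (\<sigma> (Suc k) * depth w (\<sigma> (Suc k) / 2))) = 3 / 2 * (\<Sum>k<n. \<sigma> (Suc k) * depth w (\<sigma> (Suc k) / 2))"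
        by (rule sum_distrib_left[symmetric])
      then show "(\<Sum>k<n. 3 / 2 * (\<sigma> (Suc k) * depth w (\<sigma> (Suc k) / 2))) \<le> 3 / 2 * C"
        using part[of n] by simp
    qed
    finally show "(\<Sum>k<n. ennreal (3 / 2 * (\<sigma> (Suc k) * depth w (\<sigma> (Suc k) / 2)))) \<le> ennreal (3 / 2 * C)" .
  qed auto
  then have "(\<Sum>k. ennreal (3 / 2 * (\<sigma> (Suc k) * depth w (\<sigma> (Suc k) / 2)))) + ennreal (depth w (1 / 2))
      \<le> ennreal (3 / 2 * C) + ennreal (depth w (1 / 2))" by (rule add_right_mono)
  also have "\<dots> < top" by simp
  finally have "(\<Sum>k. ennreal (3 / 2 * (\<sigma> (Suc k) * depth w (\<sigma> (Suc k) / 2)))) + ennreal (depth w (1 / 2)) < top" .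
  then have "(\<integral>\<^sup>+ t. ennreal (- ln (w t)) \<partial>circle) < top" using le by (rule le_less_trans[rotated])
  then show False using inf
    unfolding ext_integral_def by (cases "\<integral>\<^sup>+ t. ennreal (- ln (w t)) \<partial>circle"; cases "\<integral>\<^sup>+ t. ennreal (ln (w t)) \<partial>circle") auto
qed

section \<open>Small polynomials avoiding a sparse set of frequencies\<close>

lemma taylor_remainder_le:
  fixes f :: "complex \<Rightarrow> complex"
  assumes holo: "f holomorphic_on ball 0 \<rho>'" and radii: "0 < \<sigma>" "\<sigma> < \<rho>" "\<rho> < \<rho>'"
    and bound: "\<And>z. norm z \<le> \<rho> \<Longrightarrow> norm (f z) \<le> B" and z: "norm z \<le> \<sigma>"
  shows "norm (f z - (\<Sum>n\<le>N. (deriv ^^ n) f 0 / fact n * z ^ n)) \<le> B * (\<sigma> / \<rho>) ^ Suc N / (1 - \<sigma> / \<rho>)"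
proof -
  let ?a = "\<lambda>n. (deriv ^^ n) f 0 / fact n * z ^ n" and ?q = "\<sigma> / \<rho>"
  have q: "0 < ?q" "?q < 1" using radii by auto
  have B: "B \<ge> 0" using order_trans[OF norm_ge_zero bound[of 0]] radii by simp
  have a: "norm (?a n) \<le> B * ?q ^ n" for n
  proof -
    have "norm ((deriv ^^ n) f 0) \<le> fact n * B / \<rho> ^ n"
    proof (rule Cauchy_inequality)
      show "f holomorphic_on ball 0 \<rho>" using holo radii by (auto intro: holomorphic_on_subset)
      show "continuous_on (cball 0 \<rho>) f"
        using holo radii by (intro holomorphic_on_imp_continuous_on) (auto intro: holomorphic_on_subset)
    qed (use radii bound in auto)
    then have "norm ((deriv ^^ n) f 0) / fact n * norm z ^ n \<le> (B / \<rho> ^ n) * \<sigma> ^ n"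
      using z radii B by (intro mult_mono power_mono) (auto simp: field_simps)
    then show ?thesis by (simp add: norm_mult norm_divide norm_power power_divide)
  qed
  have "(\<lambda>n. (deriv ^^ n) f 0 / fact n * (z - 0) ^ n) sums f z"
    using z radii by (intro holomorphic_power_series[OF holo]) auto
  then have "?a sums f z" by simp
  then have "(\<lambda>n. ?a (n + Suc N)) sums (f z - (\<Sum>n<Suc N. ?a n))" by (rule sums_split_initial_segment)
  then have tail: "(\<lambda>n. ?a (n + Suc N)) sums (f z - (\<Sum>n\<le>N. ?a n))" by (simp only: lessThan_Suc_atMost)
  have geo: "(\<lambda>n. B * ?q ^ Suc N * ?q ^ n) sums (B * ?q ^ Suc N * (1 / (1 - ?q)))"
    using q by (intro sums_mult geometric_sums) auto
  have le: "norm (?a (n + Suc N)) \<le> B * ?q ^ Suc N * ?q ^ n" for n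
    using a[of "n + Suc N"] by (simp only: power_add mult_ac)
  have "norm (\<Sum>n. ?a (n + Suc N)) \<le> (\<Sum>n. B * ?q ^ Suc N * ?q ^ n)"
    using le geo by (intro norm_suminf_le) (auto simp: sums_iff)
  then show ?thesis using sums_unique[OF tail] sums_unique[OF geo] by simp
qed

text \<open>
  Discs in the variable \<open>t\<close> correspond to discs in \<open>z = e\<^bsup>2\<pi>it\<^esup>\<close> that are larger by the factor
  \<open>2\<pi> \<cdot> 3/2 < 13\<close> at most, up to a radius of \<open>1/20\<close>.
\<close>

lemma norm_exp_diff_le:
  fixes t :: real
  assumes "dist (of_real t) \<zeta> \<le> 1 / 20"
  shows "norm (exp (2 * of_real pi * \<i> * \<zeta>) - cis (2 * pi * t)) \<le> 13 * dist (of_real t) \<zeta>"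
proof -
  let ?v = "2 * of_real pi * \<i> * (\<zeta> - of_real t)"
  have v: "norm ?v = 2 * pi * dist (of_real t) \<zeta>"
    by (simp add: norm_mult dist_norm norm_minus_commute)
  also have "\<dots> \<le> 2 * 4 * dist (of_real t) \<zeta>" using pi_less_4 by (intro mult_right_mono) auto
  finally have v8: "norm ?v \<le> 8 * dist (of_real t) \<zeta>" by simp
  have "exp (2 * of_real pi * \<i> * \<zeta>) - cis (2 * pi * t) = cis (2 * pi * t) * (exp ?v - 1)"
    by (simp add: cis_conv_exp algebra_simps flip: exp_add)
  then have "norm (exp (2 * of_real pi * \<i> * \<zeta>) - cis (2 * pi * t)) = norm (exp ?v - 1)"
    by (simp add: norm_mult)
  also have "\<dots> \<le> 3 / 2 * norm ?v" using v8 assms by (intro norm_exp_bounds) linarith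
  finally show ?thesis using v8 zero_le_dist[of "of_real t" \<zeta>] by linarith
qed

text \<open>
  All requirements say that a quantity of order \<open>\<surd>L\<close> or \<open>1\<close> is dominated by one of order \<open>L\<close>.
  The numbers come from a mass of \<open>L/10\<^sup>8\<close> and the disc of radius \<open>\<tau>/20000\<close>: the rate of the outer function, with
  the factor \<open>13\<close> for the change of variables, is \<open>13 (2 \<cdot> 10\<^sup>6 L/10\<^sup>8 + 4\<beta>\<surd>(eL))\<close>, and the first inequality
  makes it at most \<open>L\<close>; also \<open>20000\<^sup>2 = 4 \<cdot> 10\<^sup>8\<close>.
\<close>

lemma parameter_choice:
  fixes \<beta> H \<theta> :: real
  assumes "\<beta> > 0" "H > 0" "\<theta> > 0"
  obtains L where "L > 0" "52 * (\<beta> * sqrt (exp 1 * L)) \<le> 74 / 100 * L"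
    "2 * (exp 1)\<^sup>2 * \<beta>\<^sup>2 \<le> L / 400000000"
    "3 * exp (2 * (\<beta> * sqrt (exp 1 * L)) - L / 200000000) * H \<le> \<theta>"
proof -
  have "eventually (\<lambda>L. L > 0 \<and> 52 * (\<beta> * sqrt (exp 1 * L)) \<le> 74 / 100 * L \<and>
    2 * (exp 1)\<^sup>2 * \<beta>\<^sup>2 \<le> L / 400000000 \<and> 3 * exp (2 * (\<beta> * sqrt (exp 1 * L)) - L / 200000000) * H \<le> \<theta>) at_top"
    (is "eventually ?P at_top")
  proof (intro eventually_conj)
    show "eventually (\<lambda>L::real. L > 0) at_top" by (rule eventually_gt_at_top)
    show "eventually (\<lambda>L. 52 * (\<beta> * sqrt (exp 1 * L)) \<le> 74 / 100 * L) at_top"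
      using assms by real_asymp
    show "eventually (\<lambda>L. 2 * (exp 1)\<^sup>2 * \<beta>\<^sup>2 \<le> L / 400000000) at_top"
      using assms by real_asymp
    have "((\<lambda>L. 3 * exp (2 * (\<beta> * sqrt (exp 1 * L)) - L / 200000000) * H) \<longlongrightarrow> 0) at_top"
      using assms by real_asymp
    from order_tendstoD(2)[OF this \<open>\<theta> > 0\<close>]
    show "eventually (\<lambda>L. 3 * exp (2 * (\<beta> * sqrt (exp 1 * L)) - L / 200000000) * H \<le> \<theta>) at_top"
      by (rule eventually_mono) simp
  qed
  then obtain L where "?P L" using eventually_happens' trivial_limit_at_top_linorder by blast
  then show ?thesis using that by blast
qed

text \<open>
  Gain against cost: with \<open>c \<gamma> = \<surd>(eL/\<gamma>)\<close> the damping factors cancel the majorant at \<open>eL/\<tau>\<^sup>2\<close> that the operator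
  introduces, at a price of \<open>2\<beta>\<surd>(eL)\<close> in the exponent. The mass is \<open>L/10\<^sup>8\<close>, and half of it is the gain.
\<close>

lemma outer_operator_bound:
  fixes t L \<beta> :: real
  assumes F: "finite F" "(\<Sum>\<gamma>\<in>F. 1 / sqrt (real \<gamma>)) \<le> \<beta>" "\<beta> > 0"
    and R: "R > 1" "R \<le> 2" and K: "\<And>s. s \<in> K \<Longrightarrow> 0 < s \<and> s \<le> 1 / 4 \<and> R - 1 \<le> s" "\<And>s. s \<in> K \<Longrightarrow> m s \<ge> 0"
    and L: "L > 0" "52 * (\<beta> * sqrt (exp 1 * L)) \<le> 74 / 100 * L" "2 * (exp 1)\<^sup>2 * \<beta>\<^sup>2 \<le> L / 400000000"
    and mass: "(\<Sum>s\<in>K. m s) = L / 100000000"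
  defines "c \<equiv> \<lambda>\<gamma>. sqrt (exp 1 * L / real \<gamma>)" and "z \<equiv> cis (2 * pi * t)"
  shows "norm (gap_op F (\<lambda>\<zeta>. outer K m R F c (exp (2 * of_real pi * \<i> * \<zeta>))) (of_real t)) \<le>
    3 * exp ((\<Sum>s\<in>K. m s * (Re (herglotz (pole s) z) - Re (herglotz (of_real (1 + s)) z) / 2))
      + (2 * (\<beta> * sqrt (exp 1 * L)) - L / 200000000))"
proof -
  define \<tau> where "\<tau> = norm (of_real R - z)"
  define W where "W = (\<lambda>\<zeta>. outer K m R F c (exp (2 * of_real pi * \<i> * \<zeta>)))"
  have z: "norm z = 1" by (simp add: z_def)
  have Rez: "Re z < R" using complex_Re_le_cmod[of z] z R by linarith
  have \<tau>: "\<tau> > 0" "\<tau> \<le> 3"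
    using Rez norm_triangle_ineq4[of "of_real R" z] z R by (auto simp: \<tau>_def)
  have c: "c \<gamma> \<ge> 0" for \<gamma> using L by (simp add: c_def)
  have sum_c: "(\<Sum>\<gamma>\<in>F. c \<gamma>) \<le> \<beta> * sqrt (exp 1 * L)"
  proof -
    have "(\<Sum>\<gamma>\<in>F. c \<gamma>) = (\<Sum>\<gamma>\<in>F. 1 / sqrt (real \<gamma>)) * sqrt (exp 1 * L)"
      by (simp add: c_def real_sqrt_divide sum_distrib_right)
    then show ?thesis using F(2) L by (simp add: mult_right_mono)
  qed
  have W_t: "W (of_real t) = outer K m R F c z"
    by (simp add: W_def z_def cis_conv_exp mult_ac)
  have near: "norm (exp (2 * of_real pi * \<i> * \<zeta>) - z) \<le> 13 * dist (of_real t) \<zeta>"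
    "norm (exp (2 * of_real pi * \<i> * \<zeta>) - z) \<le> \<tau> / 1000"
    if "\<zeta> \<in> cball (of_real t) (\<tau> / 20000)" for \<zeta>
  proof -
    have d: "dist (of_real t) \<zeta> \<le> \<tau> / 20000" using that by simp
    then show "norm (exp (2 * of_real pi * \<i> * \<zeta>) - z) \<le> 13 * dist (of_real t) \<zeta>"
      unfolding z_def using \<tau> by (intro norm_exp_diff_le) simp
    with d \<tau> show "norm (exp (2 * of_real pi * \<i> * \<zeta>) - z) \<le> \<tau> / 1000" by simp
  qed
  have holo: "W holomorphic_on cball (of_real t) (\<tau> / 20000)"
  proof -
    let ?S = "(\<lambda>\<zeta>. exp (2 * of_real pi * \<i> * \<zeta>)) ` cball (of_real t) (\<tau> / 20000)"
    have far: "p \<notin> ?S" if "\<tau> \<le> 402 * norm (p - z)" for p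
    proof
      assume "p \<in> ?S"
      then have "norm (p - z) \<le> \<tau> / 1000" using near(2) by auto
      then show False using that \<tau> by simp
    qed
    have "outer K m R F c holomorphic_on ?S"
    proof (rule holomorphic_outer)
      fix s assume s: "s \<in> K"
      note d = circle_distances_to_poles[OF z _ _ , of R s]
      show "pole s \<notin> ?S" using K(1)[OF s] d R by (intro far) (auto simp: \<tau>_def)
      have "norm (of_real R - z) \<le> norm (of_real (1 + s) - z)" using K(1)[OF s] d R by auto
      then show "of_real (1 + s) \<notin> ?S" using norm_ge_zero[of "of_real (1 + s) - z"] unfolding \<tau>_def[symmetric] by (intro far) linarith
    next
      fix \<gamma> assume "\<gamma> \<in> F"
      show "of_real (R + c \<gamma>) \<notin> ?S"
        using norm_shift_mono[of z R "c \<gamma>"] c[of \<gamma>] Rez norm_ge_zero[of "of_real (R + c \<gamma>) - z"]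
        unfolding \<tau>_def[symmetric] by (intro far) linarith
    qed (use c R in auto)
    then have "outer K m R F c \<circ> (\<lambda>\<zeta>. exp (2 * of_real pi * \<i> * \<zeta>)) holomorphic_on cball (of_real t) (\<tau> / 20000)"
      by (intro holomorphic_on_compose) (auto intro!: holomorphic_intros)
    then show ?thesis by (simp add: o_def W_def)
  qed
  \<comment> \<open>the operator bound with \<open>D = L/\<tau>\<^sup>2\<close> on the disc of radius \<open>\<tau>/20000\<close>, so that \<open>D r\<^sub>0\<^sup>2\<close> is \<open>L/(4 \<cdot> 10\<^sup>8)\<close>\<close>
  have "norm (gap_op F W (of_real t)) \<le> norm (W (of_real t)) * (gap_majorant F (exp 1 * (L / \<tau>\<^sup>2)) + 2)"
  proof (rule norm_gap_op_le[OF F holo order_refl])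
    fix \<zeta> :: complex assume \<zeta>: "\<zeta> \<in> cball (of_real t) (\<tau> / 20000)"
    let ?z' = "exp (2 * of_real pi * \<i> * \<zeta>)"
    have "norm (W \<zeta>) \<le> norm (W (of_real t)) *
      exp ((2 * 10 ^ 6 * (\<Sum>s\<in>K. m s) + 4 * (\<Sum>\<gamma>\<in>F. c \<gamma>)) * norm (?z' - z) / \<tau>\<^sup>2)"
      unfolding W_t unfolding W_def \<tau>_def
      using near(2)[OF \<zeta>] z R c K by (intro norm_outer_ratio_le) (auto simp: \<tau>_def)
    also have "\<dots> \<le> norm (W (of_real t)) * exp ((L / 13) * (13 * dist (of_real t) \<zeta>) / \<tau>\<^sup>2)"
    proof -
      have "0 \<le> sum m K" "0 \<le> sum c F" using K c by (auto intro: sum_nonneg)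
      moreover have "2 * 10 ^ 6 * (\<Sum>s\<in>K. m s) + 4 * (\<Sum>\<gamma>\<in>F. c \<gamma>) \<le> L / 13"
        using sum_c L mass by simp
      ultimately show ?thesis using near(1)[OF \<zeta>] L
        by (intro mult_left_mono iffD2[OF exp_le_cancel_iff] divide_right_mono mult_mono) auto
    qed
    also have "(L / 13) * (13 * dist (of_real t) \<zeta>) / \<tau>\<^sup>2 = L / \<tau>\<^sup>2 * dist (of_real t) \<zeta>" by simp
    finally show "norm (W \<zeta>) \<le> norm (W (of_real t)) * exp (L / \<tau>\<^sup>2 * dist (of_real t) \<zeta>)" .
  next
    have "L / \<tau>\<^sup>2 * (\<tau> / 20000)\<^sup>2 = L / 400000000" using \<tau> by (simp add: power_divide)
    then show "2 * (exp 1)\<^sup>2 * \<beta>\<^sup>2 \<le> L / \<tau>\<^sup>2 * (\<tau> / 20000)\<^sup>2" using L(3) by (simp only:)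
  qed (use \<tau> L in auto)
  also have "\<dots> \<le> norm (W (of_real t)) * (3 * gap_majorant F (exp 1 * (L / \<tau>\<^sup>2)))"
    using gap_majorant_ge_1[of "exp 1 * (L / \<tau>\<^sup>2)" F] L \<tau> by (intro mult_left_mono) auto
  also have "gap_majorant F (exp 1 * (L / \<tau>\<^sup>2)) = (\<Prod>\<gamma>\<in>F. 1 + (c \<gamma>)\<^sup>2 / (norm (of_real R - z))\<^sup>2)"
    using L unfolding gap_majorant_def c_def \<tau>_def[symmetric] by (simp add: mult_ac)
  also have "norm (W (of_real t)) * (3 * (\<Prod>\<gamma>\<in>F. 1 + (c \<gamma>)\<^sup>2 / (norm (of_real R - z))\<^sup>2))
     = 3 * (norm (outer K m R F c z) * (\<Prod>\<gamma>\<in>F. 1 + (c \<gamma>)\<^sup>2 / (norm (of_real R - z))\<^sup>2))"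
    by (simp add: W_t)
  also have "\<dots> \<le> 3 * exp ((\<Sum>s\<in>K. m s * (Re (herglotz (pole s) z) - Re (herglotz (of_real (1 + s)) z) / 2))
      - (\<Sum>s\<in>K. m s) / 2 + 2 * (\<Sum>\<gamma>\<in>F. c \<gamma>))"
    using z R c by (intro mult_left_mono norm_outer_mult_majorant_le) auto
  also have "\<dots> \<le> 3 * exp ((\<Sum>s\<in>K. m s * (Re (herglotz (pole s) z) - Re (herglotz (of_real (1 + s)) z) / 2))
      + (2 * (\<beta> * sqrt (exp 1 * L)) - L / 200000000))"
    using sum_c mass by simp
  finally show ?thesis by (simp add: W_def)
qed

text \<open>
  The heart of the matter: up to sign, the terms of positive degree form a linear combination of admissible
  exponentials that approximates the constant \<open>1\<close>, even uniformly with respect to the weight \<open>\<surd>w\<close>.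
\<close>

lemma small_polynomial_avoiding:
  fixes \<Gamma> :: "nat set" and w :: "real \<Rightarrow> real" and \<delta> H :: real
  assumes \<Gamma>: "\<Gamma> \<subseteq> {1..}" "(\<lambda>\<gamma>. 1 / sqrt (real \<gamma>)) summable_on \<Gamma>"
    and w: "\<And>t. t \<in> {0<..<1} \<Longrightarrow> w t > 0" "mono_on {0<..<1} w" "\<And>t. t \<in> {0<..<1} \<Longrightarrow> w t \<le> H"
    and deep: "\<And>C. \<exists>K. finite K \<and> K \<subseteq> range (\<lambda>k. (1 / 4) ^ Suc k) \<and> C \<le> (\<Sum>s\<in>K. s * depth w (s / 2))"
    and "\<delta> > 0"
  obtains N a where "a 0 = 1" "\<And>\<gamma>. \<gamma> \<in> \<Gamma> \<Longrightarrow> a \<gamma> = 0"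
    "\<And>t. t \<in> {0<..<1} \<Longrightarrow>
      (norm (\<Sum>n\<le>N. a n * exp (2 * of_real pi * \<i> * of_nat n * of_real t)))\<^sup>2 * w t \<le> \<delta>"
proof -
  define H' where "H' = sqrt (max 1 H)"
  have H': "H' \<ge> 1" "H'\<^sup>2 = max 1 H" by (auto simp: H'_def)
  define \<theta> where "\<theta> = sqrt \<delta> / 2"
  have \<theta>: "\<theta> > 0" using \<open>\<delta> > 0\<close> by (simp add: \<theta>_def)
  define \<beta> where "\<beta> = 1 + infsum (\<lambda>\<gamma>. 1 / sqrt (real \<gamma>)) \<Gamma>"
  have \<beta>: "\<beta> > 0" by (auto simp: \<beta>_def intro!: add_pos_nonneg infsum_nonneg)
  have sum_\<beta>: "(\<Sum>\<gamma>\<in>F. 1 / sqrt (real \<gamma>)) \<le> \<beta>" if "finite F" "F \<subseteq> \<Gamma>" for F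
    using finite_sum_le_infsum[OF \<Gamma>(2) that] by (simp add: \<beta>_def)
  obtain L where L: "L > 0" "52 * (\<beta> * sqrt (exp 1 * L)) \<le> 74 / 100 * L"
    "2 * (exp 1)\<^sup>2 * \<beta>\<^sup>2 \<le> L / 400000000"
    "3 * exp (2 * (\<beta> * sqrt (exp 1 * L)) - L / 200000000) * H' \<le> \<theta>"
    using parameter_choice[of \<beta> H' \<theta>] \<beta> H' \<theta> by auto
  define M where "M = L / 100000000"
  have M: "M > 0" using L by (simp add: M_def)
  obtain K where K: "finite K" "K \<subseteq> range (\<lambda>k. (1 / 4) ^ Suc k)" "1200 * M \<le> (\<Sum>s\<in>K. s * depth w (s / 2))"
    using deep by blast
  have K_range: "0 < s" "s \<le> 1 / 4" if s: "s \<in> K" for s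
  proof -
    obtain k where k: "s = (1 / 4) ^ Suc k" using s K(2) by blast
    show "0 < s" unfolding k by (rule zero_less_power) simp
    show "s \<le> 1 / 4" unfolding k by (simp add: power_le_one)
  qed
  have gaps: "s' \<le> s / 4" if ss: "s \<in> K" "s' \<in> K" "s' < s" for s s'
  proof -
    obtain j k where jk: "s = (1 / 4) ^ Suc j" "s' = (1 / 4) ^ Suc k" using ss K(2) by blast
    have "j < k"
    proof (rule ccontr)
      assume "\<not> j < k"
      then have "(1 / 4 :: real) ^ Suc j \<le> (1 / 4) ^ Suc k" by (intro power_decreasing) auto
      then show False using ss jk by linarith
    qed
    then have "(1 / 4 :: real) ^ Suc k \<le> (1 / 4) ^ Suc (Suc j)" by (intro power_decreasing) auto
    then show ?thesis by (simp add: jk)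
  qed
  define T where "T = (\<Sum>s\<in>K. s * depth w (s / 2))"
  have T: "T > 0" "1200 * M \<le> T" using K(3) M by (auto simp: T_def)
  have "K \<noteq> {}" using T by (auto simp: T_def)
  \<comment> \<open>the first factor is at most \<open>1\<close> and makes the total mass exactly \<open>M\<close>\<close>
  define m where "m s = (1200 * M / T) * (s * depth w (s / 2) / 1200)" for s
  have m: "0 \<le> m s \<and> m s \<le> s * depth w (s / 2) / 1200" if "s \<in> K" for s
  proof -
    have "0 \<le> s * depth w (s / 2) / 1200" using K_range[OF that] by (simp add: depth_def)
    moreover have "0 \<le> 1200 * M / T" "1200 * M / T \<le> 1" using T M by auto
    ultimately show ?thesis unfolding m_def by (metis mult_left_le_one_le mult_nonneg_nonneg)
  qed
  have mass: "(\<Sum>s\<in>K. m s) = L / 100000000"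
    using T M unfolding m_def by (simp add: sum_distrib_left[symmetric] sum_divide_distrib[symmetric] T_def[symmetric]) (simp add: M_def)
  \<comment> \<open>all poles lie outside the disc of radius \<open>1 + \<eta>\<close>: those of the kernels have modulus at least \<open>1 + 2\<eta>\<close>, and \<open>R = 1 + 2\<eta>\<close>\<close>
  define \<eta> where "\<eta> = Min K / 400"
  have "Min K \<in> K" using K(1) \<open>K \<noteq> {}\<close> by (rule Min_in)
  have \<eta>: "0 < \<eta>" "\<eta> \<le> 1 / 1600" using K_range[OF \<open>Min K \<in> K\<close>] by (auto simp: \<eta>_def)
  have \<eta>_less: "\<eta> \<le> s / 400" if "s \<in> K" for s using Min_le[OF K(1) that] by (simp add: \<eta>_def)
  define R where "R = 1 + 2 * \<eta>"
  define c where "c \<gamma> = sqrt (exp 1 * L / real \<gamma>)" for \<gamma> :: nat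
  have c: "c \<gamma> \<ge> 0" for \<gamma> using L by (simp add: c_def)
  obtain B where B: "B > 0" "\<And>F z. norm z \<le> 1 + \<eta> \<Longrightarrow> norm (outer K m R F c z) \<le> B * exp (2 * (\<Sum>\<gamma>\<in>F. c \<gamma>))"
  proof -
    have "\<eta> < s / 200" if "s \<in> K" for s using \<eta>_less[OF that] K_range(1)[OF that] by simp
    then obtain B where "B > 0" "\<And>F c z. (\<And>\<gamma>. c \<gamma> \<ge> 0) \<Longrightarrow> norm z \<le> 1 + \<eta> \<Longrightarrow> norm (outer K m R F c z) \<le> B * exp (2 * (\<Sum>\<gamma>\<in>F. c \<gamma>))"
      using outer_bounded[of K \<eta> R m] K(1) \<eta> by (auto simp: R_def)
    then show ?thesis using that c by blast
  qed
  define F where "F N = \<Gamma> \<inter> {..N}" for N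
  have F: "finite (F N)" "F N \<subseteq> \<Gamma>" for N by (auto simp: F_def)
  define B' where "B' = B * exp (2 * (\<beta> * sqrt (exp 1 * L)))"
  have V_le: "norm (outer K m R (F N) c z) \<le> B'" if "norm z \<le> 1 + \<eta>" for N z
  proof -
    have "(\<Sum>\<gamma>\<in>F N. c \<gamma>) = (\<Sum>\<gamma>\<in>F N. 1 / sqrt (real \<gamma>)) * sqrt (exp 1 * L)"
      by (simp add: c_def real_sqrt_divide sum_distrib_right)
    also have "\<dots> \<le> \<beta> * sqrt (exp 1 * L)" using sum_\<beta>[OF F] L by (simp add: mult_right_mono)
    finally have "B * exp (2 * (\<Sum>\<gamma>\<in>F N. c \<gamma>)) \<le> B'" using B(1) by (simp add: B'_def)
    then show ?thesis using B(2)[OF that, of "F N"] by linarith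
  qed
  have V_holo: "outer K m R (F N) c holomorphic_on ball 0 (1 + \<eta>)" for N
  proof (rule holomorphic_outer)
    fix s assume s: "s \<in> K"
    have le: "\<eta> \<le> s / 400" "0 < s" using \<eta>_less[OF s] K_range[OF s] by auto
    show "pole s \<notin> ball 0 (1 + \<eta>)" using le by (simp add: norm_pole)
    have "norm (of_real (1 + s) :: complex) = 1 + s" using le unfolding norm_of_real by auto
    then show "of_real (1 + s) \<notin> ball (0::complex) (1 + \<eta>)" using le by (simp del: of_real_add)
  next
    fix \<gamma>
    have "norm (of_real (R + c \<gamma>) :: complex) = R + c \<gamma>" using \<eta> c[of \<gamma>] unfolding norm_of_real R_def by auto
    then show "of_real (R + c \<gamma>) \<notin> ball (0::complex) (1 + \<eta>)" using c[of \<gamma>] \<eta> by (simp add: R_def del: of_real_add)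
  qed (use c \<eta> in \<open>auto simp: R_def\<close>)
  define \<rho> where "\<rho> = 1 + \<eta> / 2"
  define \<sigma> where "\<sigma> = 1 + \<eta> / 4"
  have radii: "0 < \<sigma>" "\<sigma> < \<rho>" "\<rho> < 1 + \<eta>" "1 < \<sigma>" using \<eta> by (auto simp: \<rho>_def \<sigma>_def)
  \<comment> \<open>the half-width of a strip in \<open>t\<close> that \<open>e\<^bsup>2\<pi>it\<^esup>\<close> maps into the disc of radius \<open>\<sigma>\<close>\<close>
  define r\<^sub>1 where "r\<^sub>1 = ln \<sigma> / (2 * pi)"
  have r1: "r\<^sub>1 > 0" using radii by (simp add: r\<^sub>1_def)
  \<comment> \<open>the remainder is bounded by a constant, so any rate \<open>D\<^sub>1\<close> that is admissible for the radius \<open>r\<^sub>1\<close> will do\<close>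
  define D\<^sub>1 where "D\<^sub>1 = 2 * (exp 1)\<^sup>2 * \<beta>\<^sup>2 / r\<^sub>1\<^sup>2"
  have D1: "D\<^sub>1 > 0" using r1 \<beta> by (simp add: D\<^sub>1_def)
  \<comment> \<open>the Taylor remainder of degree \<open>N\<close>, which decides the choice of \<open>N\<close> because the bound for the operator is uniform in \<open>N\<close>\<close>
  define \<kappa> where "\<kappa> N = B' * (\<sigma> / \<rho>) ^ Suc N / (1 - \<sigma> / \<rho>)" for N
  have "\<kappa> \<longlonglongrightarrow> B' * 0 / (1 - \<sigma> / \<rho>)"
    unfolding \<kappa>_def using radii by (intro tendsto_intros LIMSEQ_power_zero[THEN LIMSEQ_Suc]) auto
  then have "(\<lambda>N. \<kappa> N * (exp (\<beta> * sqrt (exp 1 * D\<^sub>1)) + 2) * H') \<longlonglongrightarrow> 0 * (exp (\<beta> * sqrt (exp 1 * D\<^sub>1)) + 2) * H'"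
    by (intro tendsto_intros) simp
  then have "eventually (\<lambda>N. \<kappa> N * (exp (\<beta> * sqrt (exp 1 * D\<^sub>1)) + 2) * H' < \<theta>) sequentially"
    using \<theta> by (intro order_tendstoD(2)) auto
  from eventually_happens'[OF sequentially_bot this]
  obtain N where N: "\<kappa> N * (exp (\<beta> * sqrt (exp 1 * D\<^sub>1)) + 2) * H' \<le> \<theta>"
    using less_imp_le by blast
  define V where "V = outer K m R (F N) c"
  define W where "W = (\<lambda>\<zeta>. V (exp (2 * of_real pi * \<i> * \<zeta>)))"
  define b where "b n = (deriv ^^ n) V 0 / fact n" for n
  define P where "P = (\<lambda>\<zeta>. \<Sum>n\<le>N. b n * exp (2 * of_real pi * \<i> * of_nat n * \<zeta>))"
  define a where "a n = (if n \<le> N then of_real (poly (gap_poly (F N)) (real n)) * b n else 0)" for n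
  have "b 0 = 1" unfolding b_def V_def
    using outer_0[of K R c m "F N"] K_range c \<eta> by (simp add: R_def)
  then have a0: "a 0 = 1" by (simp add: a_def poly_gap_poly_zero)
  have a\<Gamma>: "a \<gamma> = 0" if "\<gamma> \<in> \<Gamma>" for \<gamma>
    using that \<Gamma>(1) F(1)[of N] poly_gap_poly_root[of "F N" \<gamma>] by (auto simp: a_def F_def)
  have "B' > 0" using B by (simp add: B'_def)
  then have \<kappa>_nonneg: "\<kappa> N \<ge> 0" unfolding \<kappa>_def using radii by (intro divide_nonneg_nonneg mult_nonneg_nonneg) auto
  have P_holo: "P holomorphic_on S" for S unfolding P_def by (intro holomorphic_intros)
  have strip: "norm (exp (2 * of_real pi * \<i> * \<zeta>)) \<le> \<sigma>" if "\<zeta> \<in> cball (of_real t) r\<^sub>1" for t \<zeta>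
  proof -
    have "\<bar>Im \<zeta>\<bar> \<le> r\<^sub>1" using that abs_Im_le_cmod[of "of_real t - \<zeta>"] by (simp add: dist_norm)
    then have "2 * pi * (- Im \<zeta>) \<le> 2 * pi * r\<^sub>1" by (intro mult_left_mono) auto
    also have "\<dots> = ln \<sigma>" by (simp add: r\<^sub>1_def)
    finally have "exp (2 * pi * (- Im \<zeta>)) \<le> exp (ln \<sigma>)" by simp
    then show ?thesis using radii by simp
  qed
  have W_holo: "W holomorphic_on cball (of_real t) r\<^sub>1" for t
  proof -
    have "V holomorphic_on (\<lambda>\<zeta>. exp (2 * of_real pi * \<i> * \<zeta>)) ` cball (of_real t) r\<^sub>1"
      using strip[of _ t] radii unfolding V_def by (intro holomorphic_on_subset[OF V_holo]) fastforce
    then have "V \<circ> (\<lambda>\<zeta>. exp (2 * of_real pi * \<i> * \<zeta>)) holomorphic_on cball (of_real t) r\<^sub>1"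
      by (intro holomorphic_on_compose) (auto intro!: holomorphic_intros)
    then show ?thesis by (simp add: o_def W_def)
  qed
  have remainder: "norm (W \<zeta> - P \<zeta>) \<le> \<kappa> N" if "\<zeta> \<in> cball (of_real t) r\<^sub>1" for t \<zeta>
  proof -
    let ?z = "exp (2 * of_real pi * \<i> * \<zeta>)"
    have "P \<zeta> = (\<Sum>n\<le>N. (deriv ^^ n) V 0 / fact n * ?z ^ n)"
      by (simp add: P_def b_def exp_of_nat_mult[symmetric] mult_ac)
    then show ?thesis unfolding W_def \<kappa>_def
      using taylor_remainder_le[OF V_holo, of \<sigma> \<rho> N B' ?z N] radii V_le[of _ N] strip[OF that]
      by (simp add: V_def)
  qed
  have error: "norm (gap_op (F N) W (of_real t) - gap_op (F N) P (of_real t)) * H' \<le> \<theta>" for t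
  proof -
    have "norm (gap_op (F N) (\<lambda>\<zeta>. W \<zeta> - P \<zeta>) (of_real t)) \<le> \<kappa> N * (gap_majorant (F N) (exp 1 * D\<^sub>1) + 2)"
    proof (rule norm_gap_op_le[OF F(1) sum_\<beta>[OF F] \<beta> _ order_refl r1 D1 \<kappa>_nonneg])
      show "(\<lambda>\<zeta>. W \<zeta> - P \<zeta>) holomorphic_on cball (of_real t) r\<^sub>1" by (intro holomorphic_intros W_holo P_holo)
      show "2 * (exp 1)\<^sup>2 * \<beta>\<^sup>2 \<le> D\<^sub>1 * r\<^sub>1\<^sup>2" using r1 by (simp add: D\<^sub>1_def)
      fix \<zeta> :: complex assume \<zeta>: "\<zeta> \<in> cball (of_real t) r\<^sub>1"
      have "\<kappa> N * 1 \<le> \<kappa> N * exp (D\<^sub>1 * dist (of_real t) \<zeta>)"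
        using \<kappa>_nonneg D1 by (intro mult_left_mono) auto
      then show "norm (W \<zeta> - P \<zeta>) \<le> \<kappa> N * exp (D\<^sub>1 * dist (of_real t) \<zeta>)" using remainder[OF \<zeta>] by linarith
    qed
    also have "\<dots> \<le> \<kappa> N * (exp (\<beta> * sqrt (exp 1 * D\<^sub>1)) + 2)"
      using gap_majorant_le_exp[OF F(1) _ sum_\<beta>[OF F], of "exp 1 * D\<^sub>1" N] D1 \<kappa>_nonneg
      by (intro mult_left_mono add_right_mono) auto
    finally have "norm (gap_op (F N) (\<lambda>\<zeta>. W \<zeta> - P \<zeta>) (of_real t)) * H' \<le> \<kappa> N * (exp (\<beta> * sqrt (exp 1 * D\<^sub>1)) + 2) * H'"
      using H' by (intro mult_right_mono) auto
    moreover have "gap_op (F N) (\<lambda>\<zeta>. W \<zeta> - P \<zeta>) (of_real t) = gap_op (F N) W (of_real t) - gap_op (F N) P (of_real t)"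
      using r1 by (intro gap_op_diff[of _ "ball (of_real t) r\<^sub>1"] P_holo holomorphic_on_subset[OF W_holo[of t]]) auto
    ultimately show ?thesis using N by simp
  qed
  have main: "norm (gap_op (F N) W (of_real t)) * sqrt (w t) \<le> \<theta>" if t: "t \<in> {0<..<1}" for t
  proof -
    let ?pos = "\<Sum>s\<in>K. m s * (Re (herglotz (pole s) (cis (2 * pi * t))) - Re (herglotz (of_real (1 + s)) (cis (2 * pi * t))) / 2)"
    let ?q = "2 * (\<beta> * sqrt (exp 1 * L)) - L / 200000000"
    have "norm (gap_op (F N) W (of_real t)) \<le> 3 * exp (?pos + ?q)"
      unfolding W_def V_def c_def
    proof (rule outer_operator_bound[OF F(1) sum_\<beta>[OF F] \<beta> _ _ _ _ L(1,2,3) mass])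
      show "R > 1" "R \<le> 2" using \<eta> by (auto simp: R_def)
      show "0 < s \<and> s \<le> 1 / 4 \<and> R - 1 \<le> s" if "s \<in> K" for s
        using K_range[OF that] \<eta>_less[OF that] by (simp add: R_def)
    qed (use m in auto)
    also have "\<dots> \<le> 3 * exp (depth w t / 2 + ?q)"
      using sum_pole_kernels_le[of K m w t] K(1) K_range gaps m w t by simp
    finally have "norm (gap_op (F N) W (of_real t)) * sqrt (w t) \<le> 3 * exp ?q * (exp (depth w t / 2) * sqrt (w t))"
      using w(1)[OF t] by (simp add: exp_add mult_right_mono mult_ac)
    also have "exp (depth w t / 2) * sqrt (w t) \<le> H'"
    proof (rule power2_le_imp_le)
      have "(exp (depth w t / 2) * sqrt (w t))\<^sup>2 = exp (depth w t) * w t"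
        using w(1)[OF t] by (simp add: power_mult_distrib exp_double[symmetric])
      also have "\<dots> \<le> H'\<^sup>2" using exp_depth_mult_le[of w t] w(1,3)[OF t] H'(2) by simp
      finally show "(exp (depth w t / 2) * sqrt (w t))\<^sup>2 \<le> H'\<^sup>2" .
    qed (use H' in auto)
    finally show ?thesis using L(4) by (simp add: mult_left_mono)
  qed
  show ?thesis
  proof (rule that[of a N, OF a0 a\<Gamma>])
    fix t :: real assume t: "t \<in> {0<..<1}"
    let ?p = "\<Sum>n\<le>N. a n * exp (2 * of_real pi * \<i> * of_nat n * of_real t)"
    have p: "?p = gap_op (F N) P (of_real t)"
      unfolding P_def gap_op_exponential_sum by (intro sum.cong) (auto simp: a_def)
    have wH: "sqrt (w t) \<le> H'" using w(3)[OF t] by (simp add: H'_def)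
    have "norm ?p \<le> norm (gap_op (F N) W (of_real t)) + norm (gap_op (F N) W (of_real t) - gap_op (F N) P (of_real t))"
      unfolding p using norm_triangle_ineq4[of "gap_op (F N) W (of_real t)" "gap_op (F N) W (of_real t) - gap_op (F N) P (of_real t)"] by simp
    then have "norm ?p * sqrt (w t) \<le> (norm (gap_op (F N) W (of_real t)) + norm (gap_op (F N) W (of_real t) - gap_op (F N) P (of_real t))) * sqrt (w t)"
      using w(1)[OF t] by (intro mult_right_mono) auto
    also have "\<dots> \<le> \<theta> + norm (gap_op (F N) W (of_real t) - gap_op (F N) P (of_real t)) * H'"
      using main[OF t] wH by (simp add: distrib_right add_mono mult_left_mono)
    also have "\<dots> \<le> \<theta> + \<theta>" using error by simp
    finally have "norm ?p * sqrt (w t) \<le> sqrt \<delta>" by (simp add: \<theta>_def)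
    then have "(norm ?p * sqrt (w t))\<^sup>2 \<le> (sqrt \<delta>)\<^sup>2" using w(1)[OF t] by (intro power_mono) auto
    then show "(norm ?p)\<^sup>2 * w t \<le> \<delta>" using w(1)[OF t] \<open>\<delta> > 0\<close> by (simp add: power_mult_distrib)
  qed
qed

section \<open>Translating the set of frequencies\<close>

definition echar :: "int \<Rightarrow> real \<Rightarrow> complex" where
  "echar m t = exp (2 * of_real pi * \<i> * of_int m * of_real t)"

lemma echar_add: "echar (m + n) t = echar m t * echar n t"
  by (simp add: echar_def algebra_simps flip: exp_add)

lemma norm_echar: "norm (echar m t) = 1"
  by (simp add: echar_def norm_exp_eq_Re)

text \<open>
  These are the frequencies that have to be avoided when \<open>e\<^bsup>2\<pi>imt\<^esup>\<close> is to be approximated instead of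
  \<open>1\<close>. A translation by \<open>m\<close> enlarges a positive integer at most by the factor \<open>1 + |m|\<close>.
\<close>

lemma summable_on_shift:
  fixes \<Gamma> :: "nat set" and m :: int
  assumes "\<Gamma> \<subseteq> {1..}" "(\<lambda>\<gamma>. 1 / sqrt (real \<gamma>)) summable_on \<Gamma>"
  shows "(\<lambda>n. 1 / sqrt (real n)) summable_on {n. 1 \<le> n \<and> (int n + m \<le> 0 \<or> nat (int n + m) \<in> \<Gamma>)}"
proof -
  define A where "A = {n. 1 \<le> n \<and> int n + m \<le> 0}"
  define B where "B = {n. 1 \<le> n \<and> int n + m > 0 \<and> nat (int n + m) \<in> \<Gamma>}"
  let ?h = "\<lambda>n. nat (int n + m)"
  have "A \<subseteq> {..nat (- m)}" by (auto simp: A_def)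
  then have A: "(\<lambda>n. 1 / sqrt (real n)) summable_on A"
    by (intro summable_on_finite) (auto intro: finite_subset)
  have "(\<lambda>\<gamma>. 1 / sqrt (real \<gamma>)) summable_on (?h ` B)"
    by (rule summable_on_subset_banach[OF assms(2)]) (auto simp: B_def)
  moreover have "inj_on ?h B" by (auto simp: inj_on_def B_def)
  ultimately have "(\<lambda>n. 1 / sqrt (real (?h n))) summable_on B"
    by (simp add: summable_on_reindex o_def)
  then have "(\<lambda>n. sqrt (1 + \<bar>real_of_int m\<bar>) * (1 / sqrt (real (?h n)))) summable_on B"
    by (rule summable_on_cmult_right)
  then have "(\<lambda>n. 1 / sqrt (real n)) summable_on B"
  proof (rule summable_on_comparison_test)
    fix n assume n: "n \<in> B"
    have hn: "real (?h n) = real n + real_of_int m" "real (?h n) > 0" using n by (auto simp: B_def)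
    have "real_of_int m \<le> \<bar>real_of_int m\<bar> * real n"
      using n mult_left_mono[of 1 "real n" "\<bar>real_of_int m\<bar>"] by (auto simp: B_def)
    then have "real (?h n) \<le> (1 + \<bar>real_of_int m\<bar>) * real n" unfolding hn(1) by (simp add: algebra_simps)
    then have "sqrt (real (?h n)) \<le> sqrt (1 + \<bar>real_of_int m\<bar>) * sqrt (real n)"
      by (simp add: real_sqrt_mult[symmetric])
    then show "1 / sqrt (real n) \<le> sqrt (1 + \<bar>real_of_int m\<bar>) * (1 / sqrt (real (?h n)))"
      using hn(2) n by (simp add: B_def field_simps)
  qed auto
  with A have "(\<lambda>n. 1 / sqrt (real n)) summable_on (A \<union> B)" by (rule summable_on_union)
  also have "A \<union> B = {n. 1 \<le> n \<and> (int n + m \<le> 0 \<or> nat (int n + m) \<in> \<Gamma>)}"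
    by (auto simp: A_def B_def)
  finally show ?thesis .
qed


section \<open>Weighted uniform approximation by linear combinations\<close>

text \<open>
  Linear combinations are indexed by the functions themselves; terms with the same function are collected, so the
  family \<open>g\<close> may have repetitions.
\<close>

lemma sum_in_linear_combinations:
  assumes "finite A" "\<And>n. n \<in> A \<Longrightarrow> g n \<in> S"
  shows "(\<lambda>t. \<Sum>n\<in>A. b n * g n t) \<in> linear_combinations S"
proof -
  have "(\<Sum>n\<in>A. b n * g n t) = (\<Sum>f\<in>g ` A. (\<Sum>n\<in>{n \<in> A. g n = f}. b n) * f t)" for t
  proof -
    have "(\<Sum>n\<in>A. b n * g n t) = (\<Sum>f\<in>g ` A. \<Sum>n\<in>{n \<in> A. g n = f}. b n * g n t)"
      by (rule sum.image_gen[OF assms(1)])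
    also have "\<dots> = (\<Sum>f\<in>g ` A. (\<Sum>n\<in>{n \<in> A. g n = f}. b n) * f t)"
      unfolding sum_distrib_right by (intro sum.cong refl) auto
    finally show ?thesis .
  qed
  then show ?thesis unfolding linear_combinations_def using assms by (auto intro!: exI[of _ "g ` A"])
qed

lemma linear_combinations_add_scale:
  assumes "p \<in> linear_combinations S" "q \<in> linear_combinations S"
  shows "(\<lambda>t. p t + c * q t) \<in> linear_combinations S"
proof -
  obtain F a where p: "p = (\<lambda>t. \<Sum>g\<in>F. a g * g t)" "finite F" "F \<subseteq> S"
    using assms(1) by (auto simp: linear_combinations_def)
  obtain G b where q: "q = (\<lambda>t. \<Sum>g\<in>G. b g * g t)" "finite G" "G \<subseteq> S"
    using assms(2) by (auto simp: linear_combinations_def)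
  define d where "d g = (if g \<in> F then a g else 0) + c * (if g \<in> G then b g else 0)" for g
  have "p t + c * q t = (\<Sum>g\<in>F \<union> G. d g * g t)" for t
  proof -
    have "p t = (\<Sum>g\<in>F \<union> G. (if g \<in> F then a g else 0) * g t)"
      unfolding p(1) using p(2) q(2) by (intro sum.mono_neutral_cong_left) auto
    moreover have "q t = (\<Sum>g\<in>F \<union> G. (if g \<in> G then b g else 0) * g t)"
      unfolding q(1) using p(2) q(2) by (intro sum.mono_neutral_cong_left) auto
    ultimately show ?thesis
      by (simp add: d_def distrib_right sum.distrib sum_distrib_left mult.assoc)
  qed
  then show ?thesis unfolding linear_combinations_def using p q by (auto intro!: exI[of _ "F \<union> G"])
qed

text \<open>
  Approximation in the supremum norm with weight \<open>\<surd>w\<close> on the open interval. It is stronger than approximation in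
  \<open>L\<^sup>2(w)\<close> and free of questions of integrability.
\<close>

definition weighted_uniform_closure :: "(real \<Rightarrow> complex) set \<Rightarrow> (real \<Rightarrow> real) \<Rightarrow> (real \<Rightarrow> complex) set" where
  "weighted_uniform_closure S w = {f. \<forall>\<delta>>0. \<exists>p\<in>linear_combinations S. \<forall>t\<in>{0<..<1}. (norm (f t - p t))\<^sup>2 * w t \<le> \<delta>}"

lemma weighted_uniform_closureE:
  assumes "f \<in> weighted_uniform_closure S w" "\<delta> > 0"
  obtains p where "p \<in> linear_combinations S" "\<And>t. t \<in> {0<..<1} \<Longrightarrow> (norm (f t - p t))\<^sup>2 * w t \<le> \<delta>"
  using assms unfolding weighted_uniform_closure_def by blast

lemma norm_add_square_le: "(norm (x + y))\<^sup>2 \<le> 2 * (norm x)\<^sup>2 + 2 * (norm y)\<^sup>2"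
  for x y :: "'a :: real_normed_vector"
proof -
  have "(norm (x + y))\<^sup>2 \<le> (norm x + norm y)\<^sup>2" by (intro power_mono norm_triangle_ineq) simp
  also have "\<dots> \<le> 2 * (norm x)\<^sup>2 + 2 * (norm y)\<^sup>2"
    using sum_squares_bound[of "norm x" "norm y"] by (simp add: power2_sum)
  finally show ?thesis .
qed

lemma weighted_uniform_closure_add:
  assumes "f \<in> weighted_uniform_closure S w" "g \<in> weighted_uniform_closure S w"
    and w: "\<And>t. t \<in> {0<..<1} \<Longrightarrow> 0 \<le> w t"
  shows "(\<lambda>t. f t + g t) \<in> weighted_uniform_closure S w"
  unfolding weighted_uniform_closure_def
proof (intro CollectI allI impI)
  fix \<delta> :: real assume "\<delta> > 0"
  then have "\<delta> / 4 > 0" by simp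
  obtain p where p: "p \<in> linear_combinations S" "\<And>t. t \<in> {0<..<1} \<Longrightarrow> (norm (f t - p t))\<^sup>2 * w t \<le> \<delta> / 4"
    using weighted_uniform_closureE[OF assms(1) \<open>\<delta> / 4 > 0\<close>] by blast
  obtain q where q: "q \<in> linear_combinations S" "\<And>t. t \<in> {0<..<1} \<Longrightarrow> (norm (g t - q t))\<^sup>2 * w t \<le> \<delta> / 4"
    using weighted_uniform_closureE[OF assms(2) \<open>\<delta> / 4 > 0\<close>] by blast
  show "\<exists>p\<in>linear_combinations S. \<forall>t\<in>{0<..<1}. (norm (f t + g t - p t))\<^sup>2 * w t \<le> \<delta>"
  proof (intro bexI ballI)
    show "(\<lambda>t. p t + 1 * q t) \<in> linear_combinations S" by (rule linear_combinations_add_scale[OF p(1) q(1)])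
    fix t :: real assume t: "t \<in> {0<..<1}"
    have "(norm (f t + g t - (p t + 1 * q t)))\<^sup>2 * w t \<le> (2 * (norm (f t - p t))\<^sup>2 + 2 * (norm (g t - q t))\<^sup>2) * w t"
      using norm_add_square_le[of "f t - p t" "g t - q t"] w[OF t] by (intro mult_right_mono) (auto simp: algebra_simps)
    also have "\<dots> \<le> \<delta>" using p(2)[OF t] q(2)[OF t] by (simp add: distrib_right)
    finally show "(norm (f t + g t - (p t + 1 * q t)))\<^sup>2 * w t \<le> \<delta>" .
  qed
qed

lemma weighted_uniform_closure_scale:
  assumes "f \<in> weighted_uniform_closure S w" and w: "\<And>t. t \<in> {0<..<1} \<Longrightarrow> 0 \<le> w t"
  shows "(\<lambda>t. c * f t) \<in> weighted_uniform_closure S w"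
  unfolding weighted_uniform_closure_def
proof (intro CollectI allI impI)
  fix \<delta> :: real assume "\<delta> > 0"
  \<comment> \<open>the summand \<open>1\<close> covers the case \<open>c = 0\<close>\<close>
  define \<delta>' where "\<delta>' = \<delta> / ((norm c)\<^sup>2 + 1)"
  have pos: "(norm c)\<^sup>2 + 1 > 0" by (simp add: add_nonneg_pos)
  then have "\<delta>' > 0" using \<open>\<delta> > 0\<close> by (simp add: \<delta>'_def)
  obtain p where p: "p \<in> linear_combinations S" "\<And>t. t \<in> {0<..<1} \<Longrightarrow> (norm (f t - p t))\<^sup>2 * w t \<le> \<delta>'"
    using weighted_uniform_closureE[OF assms(1) \<open>\<delta>' > 0\<close>] by blast
  have zero: "(\<lambda>t. 0) \<in> linear_combinations S"
    using sum_in_linear_combinations[of "{}" "\<lambda>_. undefined" S "\<lambda>_. 0"] by simp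
  show "\<exists>p\<in>linear_combinations S. \<forall>t\<in>{0<..<1}. (norm (c * f t - p t))\<^sup>2 * w t \<le> \<delta>"
  proof (intro bexI ballI)
    show "(\<lambda>t. 0 + c * p t) \<in> linear_combinations S" by (rule linear_combinations_add_scale[OF zero p(1)])
    fix t :: real assume t: "t \<in> {0<..<1}"
    have "(norm (c * f t - (0 + c * p t)))\<^sup>2 * w t = (norm c)\<^sup>2 * ((norm (f t - p t))\<^sup>2 * w t)"
      by (simp add: norm_mult power_mult_distrib flip: right_diff_distrib)
    also have "\<dots> \<le> ((norm c)\<^sup>2 + 1) * \<delta>'"
      using p(2)[OF t] w[OF t] by (intro mult_mono) auto
    also have "\<dots> = \<delta>" using pos by (simp add: \<delta>'_def)
    finally show "(norm (c * f t - (0 + c * p t)))\<^sup>2 * w t \<le> \<delta>" .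
  qed
qed

text \<open>
  Multiply a small polynomial with constant term \<open>1\<close> by \<open>e\<^bsup>2\<pi>imt\<^esup>\<close>: its remaining frequencies
  \<open>n + m\<close> are admissible if the polynomial avoids the translated set of frequencies.
\<close>

lemma echar_in_weighted_uniform_closure:
  fixes \<Gamma> :: "nat set" and w :: "real \<Rightarrow> real" and H :: real and m :: int
  assumes \<Gamma>: "\<Gamma> \<subseteq> {1..}" "(\<lambda>\<gamma>. 1 / sqrt (real \<gamma>)) summable_on \<Gamma>"
    and w: "\<And>t. t \<in> {0<..<1} \<Longrightarrow> w t > 0" "mono_on {0<..<1} w" "\<And>t. t \<in> {0<..<1} \<Longrightarrow> w t \<le> H"
    and inf: "ext_integral (\<lambda>t. ln (w t)) = -\<infinity>"
  shows "echar m \<in> weighted_uniform_closure (exponentials (real ` ({1..} - \<Gamma>))) w"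
  unfolding weighted_uniform_closure_def
proof (intro CollectI allI impI)
  fix \<delta> :: real assume "\<delta> > 0"
  define \<Gamma>' where "\<Gamma>' = {n. 1 \<le> n \<and> (int n + m \<le> 0 \<or> nat (int n + m) \<in> \<Gamma>)}"
  have \<Gamma>': "\<Gamma>' \<subseteq> {1..}" "(\<lambda>n. 1 / sqrt (real n)) summable_on \<Gamma>'"
    using summable_on_shift[OF \<Gamma>, of m] by (auto simp: \<Gamma>'_def)
  obtain a :: "nat \<Rightarrow> complex" and N where a: "a 0 = 1" "\<And>n. n \<in> \<Gamma>' \<Longrightarrow> a n = 0"
    and small: "\<And>t. t \<in> {0<..<1} \<Longrightarrow> (norm (\<Sum>n\<le>N. a n * exp (2 * of_real pi * \<i> * of_nat n * of_real t)))\<^sup>2 * w t \<le> \<delta>"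
    by (rule small_polynomial_avoiding[OF \<Gamma>' w depth_sum_unbounded[OF w(1,2) inf] \<open>\<delta> > 0\<close>]) (assumption | rule that | blast)+
  define A where "A = {n. 1 \<le> n \<and> n \<le> N \<and> n \<notin> \<Gamma>'}"
  have "finite A" by (rule finite_subset[of _ "{..N}"]) (auto simp: A_def)
  define p where "p t = (\<Sum>n\<in>A. - a n * echar (int n + m) t)" for t
  have "p \<in> linear_combinations (exponentials (real ` ({1..} - \<Gamma>)))"
    unfolding p_def[abs_def] using \<open>finite A\<close>
  proof (rule sum_in_linear_combinations)
    fix n assume "n \<in> A"
    then have k: "int n + m = int (nat (int n + m))" "nat (int n + m) \<in> {1..} - \<Gamma>"
      by (auto simp: A_def \<Gamma>'_def)
    then have "echar (int n + m) = (\<lambda>t. exp (2 * of_real pi * \<i> * of_real (real (nat (int n + m))) * of_real t))"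
      by (auto simp: echar_def fun_eq_iff)
    with k(2) show "echar (int n + m) \<in> exponentials (real ` ({1..} - \<Gamma>))"
      unfolding exponentials_def by blast
  qed
  moreover have "(norm (echar m t - p t))\<^sup>2 * w t \<le> \<delta>" if t: "t \<in> {0<..<1}" for t
  proof -
    have "(\<Sum>n\<le>N. a n * exp (2 * of_real pi * \<i> * of_nat n * of_real t)) = (\<Sum>n\<in>insert 0 A. a n * echar (int n) t)"
      using a(2) by (intro sum.mono_neutral_cong_right) (auto simp: A_def echar_def)
    also have "\<dots> = 1 + (\<Sum>n\<in>A. a n * echar (int n) t)"
      using \<open>finite A\<close> a(1) by (subst sum.insert) (auto simp: A_def echar_def)
    finally have "echar m t - p t = echar m t * (\<Sum>n\<le>N. a n * exp (2 * of_real pi * \<i> * of_nat n * of_real t))"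
      by (simp add: p_def sum_negf echar_add distrib_left sum_distrib_left mult_ac)
    then show ?thesis using small[OF t] by (simp add: norm_mult norm_echar)
  qed
  ultimately show "\<exists>p\<in>linear_combinations (exponentials (real ` ({1..} - \<Gamma>))).
      \<forall>t\<in>{0<..<1}. (norm (echar m t - p t))\<^sup>2 * w t \<le> \<delta>" by blast
qed


section \<open>Uniform approximation of loops by trigonometric polynomials\<close>

inductive trig_poly :: "(real \<Rightarrow> complex) \<Rightarrow> bool" where
  char: "trig_poly (echar m)"
| add: "trig_poly p \<Longrightarrow> trig_poly q \<Longrightarrow> trig_poly (\<lambda>t. p t + q t)"
| scale: "trig_poly p \<Longrightarrow> trig_poly (\<lambda>t. c * p t)"

lemma trig_poly_mult_echar:
  assumes "trig_poly p"
  shows "trig_poly (\<lambda>t. p t * echar m t)"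
  using assms
proof induction
  case (char n)
  have "(\<lambda>t. echar n t * echar m t) = echar (n + m)" by (simp add: echar_add fun_eq_iff)
  then show ?case using trig_poly.char[of "n + m"] by simp
next
  case (add p q)
  then show ?case using trig_poly.add[OF add.IH] by (simp add: distrib_right)
next
  case (scale p c)
  then show ?case using trig_poly.scale[OF scale.IH, of c] by (simp add: mult.assoc)
qed

lemma trig_poly_mult:
  assumes "trig_poly q" "trig_poly p"
  shows "trig_poly (\<lambda>t. p t * q t)"
  using assms(1)
proof induction
  case (char n)
  then show ?case by (rule trig_poly_mult_echar[OF assms(2)])
next
  case (add q1 q2)
  then show ?case using trig_poly.add[OF add.IH] by (simp add: distrib_left)
next
  case (scale q c)
  then show ?case using trig_poly.scale[OF scale.IH, of c] by (simp add: mult_ac)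
qed

lemma trig_poly_const: "trig_poly (\<lambda>t. c)"
  using trig_poly.scale[OF trig_poly.char[of 0], of c] by (simp add: echar_def)

text \<open>
  The real and the imaginary part of \<open>e\<^bsup>2\<pi>it\<^esup>\<close> are trigonometric polynomials, and trigonometric polynomials
  form an algebra.
\<close>

lemma trig_poly_real_polynomial:
  assumes "real_polynomial_function p"
  shows "trig_poly (\<lambda>t. of_real (p (cis (2 * pi * t))))"
  using assms
proof induction
  case (linear f)
  interpret bounded_linear f by fact
  have lin: "f z = Re z * f 1 + Im z * f \<i>" for z
  proof -
    have "f (Re z *\<^sub>R 1 + Im z *\<^sub>R \<i>) = Re z * f 1 + Im z * f \<i>" by (simp add: add scaleR)
    moreover have "Re z *\<^sub>R 1 + Im z *\<^sub>R \<i> = z" by (simp add: complex_eq_iff)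
    ultimately show ?thesis by simp
  qed
  then have "complex_of_real (f (cis (2 * pi * t))) =
    Complex (f 1 / 2) (- f \<i> / 2) * echar 1 t + Complex (f 1 / 2) (f \<i> / 2) * echar (-1) t" for t
  proof -
    have "echar 1 t = cis (2 * pi * t)" "echar (-1) t = cis (- (2 * pi * t))"
      by (simp_all add: echar_def cis_conv_exp mult_ac)
    then show ?thesis
      unfolding lin[of "cis (2 * pi * t)"] by (simp add: complex_eq_iff field_simps)
  qed
  then show ?case by (simp only:) (intro trig_poly.intros)
next
  case (const c)
  then show ?case by (rule trig_poly_const)
next
  case (add f g)
  then show ?case using trig_poly.add[OF add.IH] by simp
next
  case (mult f g)
  then show ?case using trig_poly_mult[OF mult.IH] by (simp add: mult.commute)
qed

text \<open>
  A loop is a continuous function on the unit circle in the plane, where the Stone--Weierstrass theorem provides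
  polynomials in two real variables.
\<close>

lemma continuous_loop_trig_approx:
  fixes h :: "real \<Rightarrow> complex"
  assumes "continuous_on {0..1} h" "h 0 = h 1" "e > 0"
  obtains p where "trig_poly p" "\<And>t. t \<in> {0..1} \<Longrightarrow> norm (h t - p t) < e"
proof -
  define g where "g z = h (Arg2pi z / (2 * pi))" for z
  have g: "g (cis (2 * pi * t)) = h t" if t: "t \<in> {0..1}" for t
  proof (cases "t = 1")
    case True
    have "Arg2pi 1 = 0" by (rule Arg2pi_unique[of 1]) auto
    then show ?thesis using True assms(2) by (simp add: g_def)
  next
    case False
    then have "Arg2pi (cis (2 * pi * t)) = 2 * pi * t"
      using t by (intro Arg2pi_unique[of 1]) (auto simp: cis_conv_exp)
    then show ?thesis by (simp add: g_def)
  qed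
  have surj: "\<exists>t\<in>{0..1}. z = cis (2 * pi * t)" if "z \<in> sphere 0 1" for z
  proof (intro bexI)
    have "z = of_real (norm z) * exp (\<i> * of_real (Arg2pi z))" by (rule Arg2pi_eq)
    then show "z = cis (2 * pi * (Arg2pi z / (2 * pi)))" using that by (simp add: cis_conv_exp)
    show "Arg2pi z / (2 * pi) \<in> {0..1}" using Arg2pi_ge_0[of z] Arg2pi_lt_2pi[of z] by (simp add: less_imp_le)
  qed
  \<comment> \<open>the parametrisation of the circle is a closed map, so \<open>g\<close> is continuous also at the point \<open>1\<close>\<close>
  have "continuous_on (sphere 0 1) g"
  proof (subst continuous_on_closed_vimage, simp, intro allI impI)
    fix B :: "complex set" assume "closed B"
    have image: "g -` B \<inter> sphere 0 1 = (\<lambda>t. cis (2 * pi * t)) ` (h -` B \<inter> {0..1})"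
    proof (intro equalityI subsetI)
      fix z assume z: "z \<in> g -` B \<inter> sphere 0 1"
      then obtain t where "t \<in> {0..1}" "z = cis (2 * pi * t)" using surj by blast
      then show "z \<in> (\<lambda>t. cis (2 * pi * t)) ` (h -` B \<inter> {0..1})" using z g by auto
    qed (use g in auto)
    have "closed (h -` B \<inter> {0..1})"
      using assms(1) \<open>closed B\<close> by (simp add: continuous_on_closed_vimage)
    then have "compact ({0..1} \<inter> (h -` B \<inter> {0..1}))"
      by (intro compact_Int_closed) auto
    moreover have "{0..1} \<inter> (h -` B \<inter> {0..1}) = h -` B \<inter> {0..1}" by auto
    ultimately have "compact (h -` B \<inter> {0..1})" by simp
    then have "compact ((\<lambda>t. cis (2 * pi * t)) ` (h -` B \<inter> {0..1}))"
      by (intro compact_continuous_image continuous_intros)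
    then show "closed (g -` B \<inter> sphere 0 1)" unfolding image by (rule compact_imp_closed)
  qed
  then obtain q where q: "polynomial_function q" "\<And>z. z \<in> sphere 0 1 \<Longrightarrow> norm (g z - q z) < e"
    using Stone_Weierstrass_polynomial_function[of "sphere 0 1" g e] \<open>e > 0\<close> by auto
  have "real_polynomial_function (Re \<circ> q)" "real_polynomial_function (Im \<circ> q)"
    using q(1) bounded_linear_Re bounded_linear_Im by (auto simp: polynomial_function_def)
  note parts = this[THEN trig_poly_real_polynomial]
  have "trig_poly (\<lambda>t. of_real ((Re \<circ> q) (cis (2 * pi * t))) + \<i> * of_real ((Im \<circ> q) (cis (2 * pi * t))))"
    by (intro trig_poly.intros(2,3) parts)
  also have "(\<lambda>t. of_real ((Re \<circ> q) (cis (2 * pi * t))) + \<i> * of_real ((Im \<circ> q) (cis (2 * pi * t)))) = (\<lambda>t. q (cis (2 * pi * t)))"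
    by (auto simp: complex_eq_iff)
  finally have "trig_poly (\<lambda>t. q (cis (2 * pi * t)))" .
  then show ?thesis
  proof (rule that)
    fix t :: real assume "t \<in> {0..1}"
    then show "norm (h t - q (cis (2 * pi * t))) < e"
      using q(2)[of "cis (2 * pi * t)"] g[of t] by simp
  qed
qed

section \<open>Continuous functions in the weighted space\<close>

lemma L2_integrable_diff:
  assumes "weight w" "f \<in> L2 w" "g \<in> L2 w"
  shows "(\<lambda>t. f t - g t) \<in> L2 w"
proof -
  have w: "\<And>t. t \<in> {0..1} \<Longrightarrow> 0 \<le> w t" "w \<in> borel_measurable circle"
    using assms(1) by (auto simp: weight_def)
  have [measurable]: "f \<in> borel_measurable circle" "g \<in> borel_measurable circle" "w \<in> borel_measurable circle"
    using assms w by (auto simp: L2_def)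
  have "integrable circle (\<lambda>t. 2 * ((norm (f t))\<^sup>2 * w t) + 2 * ((norm (g t))\<^sup>2 * w t))"
    using assms(2,3) by (auto simp: L2_def)
  then have "integrable circle (\<lambda>t. (norm (f t - g t))\<^sup>2 * w t)"
  proof (rule Bochner_Integration.integrable_bound)
    show "AE t in circle. norm ((norm (f t - g t))\<^sup>2 * w t) \<le> norm (2 * ((norm (f t))\<^sup>2 * w t) + 2 * ((norm (g t))\<^sup>2 * w t))"
    proof (rule AE_I2)
      fix t assume "t \<in> space circle"
      then have "0 \<le> w t" using w by simp
      then have "(norm (f t - g t))\<^sup>2 * w t \<le> (2 * (norm (f t))\<^sup>2 + 2 * (norm (g t))\<^sup>2) * w t"
        using norm_add_square_le[of "f t" "- g t"] by (intro mult_right_mono) auto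
      then show "norm ((norm (f t - g t))\<^sup>2 * w t) \<le> norm (2 * ((norm (f t))\<^sup>2 * w t) + 2 * ((norm (g t))\<^sup>2 * w t))"
        using \<open>0 \<le> w t\<close> by (simp add: algebra_simps)
    qed
  qed measurable
  then show ?thesis by (simp add: L2_def)
qed

lemma bounded_in_L2:
  assumes "weight w" "f \<in> borel_measurable circle" "\<And>t. t \<in> {0..1} \<Longrightarrow> norm (f t) \<le> B"
  shows "f \<in> L2 w"
proof -
  have w: "\<And>t. t \<in> {0..1} \<Longrightarrow> 0 \<le> w t" "integrable circle w" using assms(1) by (auto simp: weight_def)
  have [measurable]: "f \<in> borel_measurable circle" "w \<in> borel_measurable circle" using assms w by auto
  have "integrable circle (\<lambda>t. B\<^sup>2 * w t)" using w by simp
  then have "integrable circle (\<lambda>t. (norm (f t))\<^sup>2 * w t)"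
  proof (rule Bochner_Integration.integrable_bound)
    show "AE t in circle. norm ((norm (f t))\<^sup>2 * w t) \<le> norm (B\<^sup>2 * w t)"
      using w assms(3) by (intro AE_I2) (auto intro!: mult_right_mono power_mono)
  qed measurable
  then show ?thesis by (simp add: L2_def)
qed


lemma L2_approx_bounded:
  assumes "weight w" "f \<in> L2 w" "e > 0"
  obtains B f' where "B > 0" "f' \<in> borel_measurable circle" "\<And>t. norm (f' t) \<le> B"
    "(LINT t|circle. (norm (f t - f' t))\<^sup>2 * w t) < e"
proof -
  have w: "\<And>t. t \<in> {0..1} \<Longrightarrow> 0 \<le> w t" using assms(1) by (auto simp: weight_def)
  have [measurable]: "f \<in> borel_measurable circle" "w \<in> borel_measurable circle"
    using assms by (auto simp: weight_def L2_def)
  define F where "F n t = (if norm (f t) \<le> real n then f t else 0)" for n t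
  have [measurable]: "F n \<in> borel_measurable circle" for n unfolding F_def by measurable
  have "(\<lambda>n. LINT t|circle. (norm (f t - F n t))\<^sup>2 * w t) \<longlonglongrightarrow> (LINT t|circle. 0)"
  proof (rule integral_dominated_convergence)
    show "integrable circle (\<lambda>t. (norm (f t))\<^sup>2 * w t)" using assms(2) by (simp add: L2_def)
    show "AE t in circle. (\<lambda>n. (norm (f t - F n t))\<^sup>2 * w t) \<longlonglongrightarrow> 0"
    proof (rule AE_I2)
      fix t
      obtain N where N: "norm (f t) \<le> real N" using real_arch_simple by blast
      have "(norm (f t - F n t))\<^sup>2 * w t = 0" if "n \<ge> N" for n
        using N that by (simp add: F_def)
      then show "(\<lambda>n. (norm (f t - F n t))\<^sup>2 * w t) \<longlonglongrightarrow> 0"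
        by (intro tendsto_eventually) (auto simp: eventually_sequentially)
    qed
    show "AE t in circle. norm ((norm (f t - F n t))\<^sup>2 * w t) \<le> (norm (f t))\<^sup>2 * w t" for n
      using w by (intro AE_I2) (auto simp: F_def abs_mult)
  qed measurable
  then have "eventually (\<lambda>n. (LINT t|circle. (norm (f t - F n t))\<^sup>2 * w t) < e) sequentially"
    using \<open>e > 0\<close> by (intro order_tendstoD(2)) auto
  from eventually_happens'[OF sequentially_bot this]
  obtain n where "(LINT t|circle. (norm (f t - F n t))\<^sup>2 * w t) < e" by blast
  moreover have "norm (F n t) \<le> real n + 1" for t by (auto simp: F_def)
  ultimately show ?thesis using that[of "real n + 1" "F n"] by auto
qed

text \<open>
  A measurable function is almost everywhere a limit of continuous functions. Clipped at \<open>B\<close> they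
  remain dominated, and cut off near both ends of the interval they become loops.
\<close>

lemma L2_approx_continuous_loop:
  fixes f :: "real \<Rightarrow> complex"
  assumes "weight w" "f \<in> borel_measurable circle" "B > 0" "\<And>t. norm (f t) \<le> B" "e > 0"
  obtains h where "continuous_on UNIV h" "h 0 = 0" "h 1 = 0"
    "(LINT t|circle. (norm (f t - h t))\<^sup>2 * w t) < e"
proof -
  have w: "\<And>t. t \<in> {0..1} \<Longrightarrow> 0 \<le> w t" "integrable circle w" using assms(1) by (auto simp: weight_def)
  have [measurable]: "f \<in> borel_measurable circle" "w \<in> borel_measurable circle"
    using assms w by auto
  have "f measurable_on {0..1}"
    using assms(2) by (subst measurable_on_iff_borel_measurable) auto
  then obtain N g where N: "negligible N" and g: "\<And>n. continuous_on UNIV (g n)"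
    "\<And>x. x \<notin> N \<Longrightarrow> (\<lambda>n. g n x) \<longlonglongrightarrow> (if x \<in> {0..1} then f x else 0)"
    unfolding measurable_on_def by blast
  define clip where "clip z = of_real (B / max B (norm z)) * z" for z :: complex
  have clip_cont: "continuous_on UNIV clip"
    unfolding clip_def using \<open>B > 0\<close> by (intro continuous_intros) (auto simp: max_def)
  have clip_id: "clip z = z" if "norm z \<le> B" for z using that \<open>B > 0\<close> by (simp add: clip_def max_def)
  have clip_le: "norm (clip z) \<le> B" for z
    using \<open>B > 0\<close> by (auto simp: clip_def norm_mult norm_divide max_def)
  \<comment> \<open>vanishes at both ends of the interval and tends to \<open>1\<close> inside\<close>
  define cutoff where "cutoff n t = max 0 (min 1 (min (real n * t) (real n * (1 - t))))" for n t
  define h where "h n t = of_real (cutoff n t) * clip (g n t)" for n t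
  have h_cont: "continuous_on UNIV (h n)" for n
    unfolding h_def cutoff_def using continuous_on_compose2[OF clip_cont g(1)[of n]]
    by (intro continuous_intros) auto
  have h_end: "h n 0 = 0" "h n 1 = 0" for n by (simp_all add: h_def cutoff_def)
  have h_le: "norm (h n t) \<le> B" for n t
  proof -
    have "norm (h n t) = cutoff n t * norm (clip (g n t))" by (simp add: h_def norm_mult cutoff_def)
    also have "\<dots> \<le> 1 * B" using clip_le by (intro mult_mono) (auto simp: cutoff_def)
    finally show ?thesis by simp
  qed
  have [measurable]: "h n \<in> borel_measurable circle" for n
    using h_cont[of n] by (intro continuous_imp_measurable_on_sets_lebesgue) (auto intro: continuous_on_subset)
  have lim: "(\<lambda>n. h n t) \<longlonglongrightarrow> f t" if t: "t \<in> {0<..<1}" "t \<notin> N" for t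
  proof -
    have "(\<lambda>n. g n t) \<longlonglongrightarrow> f t" using g(2)[OF t(2)] t(1) by simp
    moreover have "isCont clip (f t)" using clip_cont by (simp add: continuous_on_eq_continuous_at)
    ultimately have "(\<lambda>n. clip (g n t)) \<longlonglongrightarrow> clip (f t)" by (rule isCont_tendsto_compose[rotated])
    then have cl: "(\<lambda>n. clip (g n t)) \<longlonglongrightarrow> f t" using clip_id assms(4) by simp
    obtain M where M: "1 / min t (1 - t) \<le> real M" using real_arch_simple by blast
    have "cutoff n t = 1" if "n \<ge> M" for n
    proof -
      have pos: "min t (1 - t) > 0" using t by simp
      have "1 / min t (1 - t) \<le> real n" using M that by linarith
      then have "1 \<le> real n * min t (1 - t)" using pos by (simp add: divide_le_eq)
      moreover have "real n * min t (1 - t) \<le> real n * t" "real n * min t (1 - t) \<le> real n * (1 - t)"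
        by (intro mult_left_mono; simp)+
      ultimately show ?thesis by (simp add: cutoff_def)
    qed
    then have "eventually (\<lambda>n. cutoff n t = 1) sequentially" by (auto simp: eventually_sequentially)
    then have "eventually (\<lambda>n. clip (g n t) = h n t) sequentially" by eventually_elim (simp add: h_def)
    with cl show ?thesis by (rule Lim_transform_eventually)
  qed
  have "(\<lambda>n. LINT t|circle. (norm (f t - h n t))\<^sup>2 * w t) \<longlonglongrightarrow> (LINT t|circle. 0)"
  proof (rule integral_dominated_convergence)
    show "integrable circle (\<lambda>t. (2 * B)\<^sup>2 * w t)" using w by simp
    have "negligible (N \<union> {0, 1})" using N by (intro negligible_Un) auto
    then have "N \<union> {0, 1} \<in> null_sets lebesgue" by (simp add: negligible_iff_null_sets)
    from AE_not_in[OF this] have "AE t in lebesgue. t \<in> {0..1} \<longrightarrow> (\<lambda>n. (norm (f t - h n t))\<^sup>2 * w t) \<longlonglongrightarrow> 0"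
    proof (rule eventually_mono, intro impI)
      fix t assume "t \<notin> N \<union> {0, 1}" "t \<in> {0..1}"
      then have "(\<lambda>n. h n t) \<longlonglongrightarrow> f t" by (intro lim) auto
      then have "(\<lambda>n. (norm (f t - h n t))\<^sup>2 * w t) \<longlonglongrightarrow> (norm (f t - f t))\<^sup>2 * w t"
        by (intro tendsto_intros)
      then show "(\<lambda>n. (norm (f t - h n t))\<^sup>2 * w t) \<longlonglongrightarrow> 0" by simp
    qed
    then show "AE t in circle. (\<lambda>n. (norm (f t - h n t))\<^sup>2 * w t) \<longlonglongrightarrow> 0"
      by (subst AE_restrict_space_iff) simp_all
    show "AE t in circle. norm ((norm (f t - h n t))\<^sup>2 * w t) \<le> (2 * B)\<^sup>2 * w t" for n
    proof (rule AE_I2)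
      fix t assume "t \<in> space circle"
      then have "0 \<le> w t" using w by simp
      moreover have "norm (f t - h n t) \<le> 2 * B"
        using norm_triangle_ineq4[of "f t" "h n t"] assms(4)[of t] h_le[of n t] by linarith
      then have "(norm (f t - h n t))\<^sup>2 \<le> (2 * B)\<^sup>2" by (intro power_mono) auto
      ultimately show "norm ((norm (f t - h n t))\<^sup>2 * w t) \<le> (2 * B)\<^sup>2 * w t"
        by (simp add: abs_mult mult_right_mono)
    qed
  qed measurable
  then have "eventually (\<lambda>n. (LINT t|circle. (norm (f t - h n t))\<^sup>2 * w t) < e) sequentially"
    using \<open>e > 0\<close> by (intro order_tendstoD(2)) auto
  from eventually_happens'[OF sequentially_bot this]
  obtain n where "(LINT t|circle. (norm (f t - h n t))\<^sup>2 * w t) < e" by blast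
  then show ?thesis using that[of "h n"] h_cont h_end by blast
qed



section \<open>Completeness\<close>

theorem theorem1:
  fixes \<Gamma> :: "nat set" and w :: "real \<Rightarrow> real"
  assumes "\<Gamma> \<subseteq> {1..}"
    and "(\<lambda>\<gamma>. 1 / sqrt (real \<gamma>)) summable_on \<Gamma>"
    and "weight w" and "condition_A w"
  shows "spans_L2 (exponentials (real ` ({1..} - \<Gamma>))) w"
proof -
  define S where "S = exponentials (real ` ({1..} - \<Gamma>))"
  have w0: "\<And>t. t \<in> {0..1} \<Longrightarrow> 0 \<le> w t" "integrable circle w" using assms(3) by (auto simp: weight_def)
  have w: "\<And>t. t \<in> {0<..<1} \<Longrightarrow> w t > 0" "mono_on {0<..<1} w"
    and inf: "ext_integral (\<lambda>t. ln (w t)) = -\<infinity>" and "bounded (w ` {0<..<1})"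
    using assms(4) by (auto simp: condition_A_def)
  then obtain H where H: "\<And>t. t \<in> {0<..<1} \<Longrightarrow> w t \<le> H"
    unfolding bounded_iff by force
  have S_L2: "S \<subseteq> L2 w"
  proof
    fix g assume "g \<in> S"
    then obtain l where g: "g = (\<lambda>t. exp (2 * of_real pi * \<i> * of_real l * of_real t))"
      by (auto simp: S_def exponentials_def)
    have "continuous_on {0..1} g" unfolding g by (intro continuous_intros)
    then have "g \<in> borel_measurable circle" by (intro continuous_imp_measurable_on_sets_lebesgue) auto
    then show "g \<in> L2 w" by (rule bounded_in_L2[OF assms(3), of g 1]) (simp add: g norm_exp_eq_Re)
  qed
  have trig: "p \<in> weighted_uniform_closure S w" if "trig_poly p" for p
    using that
  proof induction
    case (char m)
    show ?case unfolding S_def by (rule echar_in_weighted_uniform_closure[OF assms(1,2) w H inf])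
  next
    case (add p q)
    then show ?case using w(1) by (intro weighted_uniform_closure_add) (auto simp: less_imp_le)
  next
    case (scale p c)
    then show ?case using w(1) by (intro weighted_uniform_closure_scale) (auto simp: less_imp_le)
  qed
  have "\<exists>p\<in>linear_combinations S. L2_norm w (\<lambda>t. f t - p t) < \<epsilon>" if f: "f \<in> L2 w" and "\<epsilon> > 0" for f \<epsilon>
  proof -
    define e where "e = \<epsilon>\<^sup>2 / 32"
    have e: "e > 0" using \<open>\<epsilon> > 0\<close> by (simp add: e_def)
    obtain B f' where f': "B > 0" "f' \<in> borel_measurable circle" "\<And>t. norm (f' t) \<le> B"
      "(LINT t|circle. (norm (f t - f' t))\<^sup>2 * w t) < e"
      using L2_approx_bounded[OF assms(3) f e] by blast
    obtain h where h: "continuous_on UNIV h" "h 0 = 0" "h 1 = 0"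
      "(LINT t|circle. (norm (f' t - h t))\<^sup>2 * w t) < e"
      using L2_approx_continuous_loop[OF assms(3) f'(2,1,3) e] by blast
    define e' where "e' = sqrt (e / (\<bar>H\<bar> + 1))"
    have e': "e' > 0" using e by (simp add: e'_def add_nonneg_pos)
    have "continuous_on {0..1} h" using h(1) by (rule continuous_on_subset) simp
    then obtain q where q: "trig_poly q" "\<And>t. t \<in> {0..1} \<Longrightarrow> norm (h t - q t) < e'"
      using continuous_loop_trig_approx[of h e'] h(2,3) e' by auto
    obtain p where p: "p \<in> linear_combinations S" "\<And>t. t \<in> {0<..<1} \<Longrightarrow> (norm (q t - p t))\<^sup>2 * w t \<le> e"
      using weighted_uniform_closureE[OF trig[OF q(1)] e] by blast
    have f'_L2: "f' \<in> L2 w" using assms(3) f'(2,3) by (rule bounded_in_L2)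
    have "bounded (h ` {0..1})"
      using \<open>continuous_on {0..1} h\<close> by (intro compact_imp_bounded compact_continuous_image) auto
    then obtain C where C: "\<forall>z\<in>h ` {0..1}. norm z \<le> C"
      unfolding bounded_iff by blast
    have h_L2: "h \<in> L2 w"
      using assms(3) continuous_imp_measurable_on_sets_lebesgue[OF \<open>continuous_on {0..1} h\<close>] C
      by (intro bounded_in_L2) auto
    have int: "integrable circle (\<lambda>t. (norm (f t - f' t))\<^sup>2 * w t)" "integrable circle (\<lambda>t. (norm (f' t - h t))\<^sup>2 * w t)"
      using L2_integrable_diff[OF assms(3) f f'_L2] L2_integrable_diff[OF assms(3) f'_L2 h_L2] by (auto simp: L2_def)
    let ?b = "\<lambda>t. 4 * ((norm (f t - f' t))\<^sup>2 * w t) + 4 * ((norm (f' t - h t))\<^sup>2 * w t) + 8 * e"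
    have pointwise: "(norm (f t - p t))\<^sup>2 * w t \<le> ?b t" if t: "t \<in> {0<..<1}" for t
    proof -
      have "(norm (f t - p t))\<^sup>2 \<le> 2 * (norm (f t - h t))\<^sup>2 + 2 * (norm (h t - p t))\<^sup>2"
        using norm_add_square_le[of "f t - h t" "h t - p t"] by simp
      also have "\<dots> \<le> 2 * (2 * (norm (f t - f' t))\<^sup>2 + 2 * (norm (f' t - h t))\<^sup>2)
          + 2 * (2 * (norm (h t - q t))\<^sup>2 + 2 * (norm (q t - p t))\<^sup>2)"
        using norm_add_square_le[of "f t - f' t" "f' t - h t"] norm_add_square_le[of "h t - q t" "q t - p t"] by simp
      finally have "(norm (f t - p t))\<^sup>2 * w t \<le> (2 * (2 * (norm (f t - f' t))\<^sup>2 + 2 * (norm (f' t - h t))\<^sup>2)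
          + 2 * (2 * (norm (h t - q t))\<^sup>2 + 2 * (norm (q t - p t))\<^sup>2)) * w t"
        using w(1)[OF t] by (intro mult_right_mono) auto
      also have "\<dots> = 4 * ((norm (f t - f' t))\<^sup>2 * w t) + 4 * ((norm (f' t - h t))\<^sup>2 * w t)
          + 4 * ((norm (h t - q t))\<^sup>2 * w t) + 4 * ((norm (q t - p t))\<^sup>2 * w t)" by (simp add: algebra_simps)
      also have "(norm (h t - q t))\<^sup>2 * w t \<le> e'\<^sup>2 * (\<bar>H\<bar> + 1)"
        using q(2)[of t] w(1)[OF t] H[OF t] t by (intro mult_mono power_mono) auto
      also have "\<dots> = e" using e by (simp add: e'_def)
      finally show ?thesis using p(2)[OF t] by simp
    qed
    have "{0, 1 :: real} \<in> null_sets lebesgue" by (simp add: negligible_iff_null_sets[symmetric])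
    from AE_not_in[OF this] have "AE t::real in lebesgue. t \<in> {0..1} \<longrightarrow> t \<in> {0<..<1}"
      by (rule eventually_mono) auto
    then have interior: "AE t in circle. t \<in> {0<..<1}" by (subst AE_restrict_space_iff) simp_all
    have int_b: "integrable circle ?b" using int by (intro Bochner_Integration.integrable_add integrable_mult_right) auto
    have "(LINT t|circle. (norm (f t - p t))\<^sup>2 * w t) \<le> (LINT t|circle. ?b t)"
    proof (rule integral_mono_AE'[OF int_b])
      show "AE t in circle. (norm (f t - p t))\<^sup>2 * w t \<le> ?b t"
        using interior by eventually_elim (rule pointwise)
      show "AE t in circle. 0 \<le> ?b t" using w0 e by (intro AE_I2) simp
    qed
    also have "\<dots> = 4 * (LINT t|circle. (norm (f t - f' t))\<^sup>2 * w t) + 4 * (LINT t|circle. (norm (f' t - h t))\<^sup>2 * w t) + 8 * e"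
      using int by (simp add: measure_restrict_space)
    also have "\<dots> < 16 * e" using f'(4) h(4) by simp
    also have "\<dots> < \<epsilon>\<^sup>2" using \<open>\<epsilon> > 0\<close> by (simp add: e_def)
    finally have "L2_norm w (\<lambda>t. f t - p t) < \<epsilon>"
      unfolding L2_norm_def using \<open>\<epsilon> > 0\<close> by (intro real_less_lsqrt) auto
    then show ?thesis using p(1) by blast
  qed
  then show ?thesis using S_L2 unfolding spans_L2_def S_def by blast
qed

end
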